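(* Let $n>2$ be even, $\sigma>0$, $j\in\{1,\dots,n/2\}$ and $z\in\mathbb{C}$. Let $\tilde z$ and $\tilde{\underline\zeta}^{(j)}$ be the vectors obtained by stacking the real and imaginary parts of $z$ and $\underline\zeta^{(j)}$ respectively. Then $$h_n^{(j)}(\tilde z,\sigma)=\int_{\mathbb{R}^{n-2}}g_j(\tilde{\underline\zeta}^{(j)},\tilde z,\sigma)\,e^{-\frac{1}{\sigma^2}\nu_j(\tilde{\underline\zeta}^{(j)},\tilde z)}\,d\tilde{\underline\zeta}^{(j)},$$ where $$g_j(\tilde{\underline\zeta}^{(j)},\tilde z,\sigma)=\frac{1}{\sigma^n\pi^{n/2}}\sum_{k=0}^{n/2}\frac{\sigma^{2k}}{2^k}\,\beta_k(\tilde{\underline\zeta}^{(j)},\tilde z)\,\frac{\prod_{r<h;\ r,h\ne j}|\tilde\zeta_r-\tilde\zeta_h|^8\prod_{r\ne j}|\tilde\zeta_r-\tilde z|^8}{D_j^{\,n-k+\frac12}(\tilde{\underline\zeta}^{(j)},\tilde z)} .$$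
   Context: Let $n$ be even, $s_k=\sum_{l=1}^{p^*}c_l\xi_l^k$, $k=0,\dots,n-1$, with $c_l,\xi_l\in\mathbb{C}$, the $\xi_l$ distinct, $p^*\le n/2$, and $\underline s=(s_0,\dots,s_{n-1})^T$. Write $\underline\zeta^{(j)}=\{\zeta_h: h\in\{1,\dots,n/2\},\,h\ne j\}\in\mathbb{C}^{n/2-1}$ and $\underline\gamma=(\gamma_1,\dots,\gamma_{n/2})^T\in\mathbb{C}^{n/2}$. Functions of complex variables are identified with functions of their real and imaginary parts; $\tilde\zeta_r\in\mathbb{R}^2$ is the real vector of $\zeta_r$ and $|\cdot|$ on $\mathbb{R}^2$ is the Euclidean norm. For $n\ge4$ the function $h_n^{(j)}$ (whose average over $j$ is the condensed density $h_n=\frac2n\sum_{j=1}^{n/2}h_n^{(j)}$ of the generalized eigenvalues of the noisy Hankel pencil) is $$h_n^{(j)}(z,\sigma)=\frac{1}{(\pi\sigma^2)^{n}}\int_{\mathbb{R}^{n-2}}\int_{\mathbb{R}^{n}}|J_C^*|^2\,e^{-\frac{1}{\sigma^2}\sum_{k=0}^{n-1}\left|\sum_{h\ne j}\gamma_h\zeta_h^k+\gamma_jz^k-s_k\right|^2}\,d\Re\underline\gamma\,d\Im\underline\gamma\,d\Re\underline\zeta^{(j)}\,d\Im\underline\zeta^{(j)},$$ $$J_C^*=(-1)^{n/2}\prod_{i=1}^{n/2}\gamma_i\prod_{r<h;\ r,h\ne j}(\zeta_r-\zeta_h)^4\prod_{r\ne j}(\zeta_r-z)^4 .$$ Let $X_j\in\mathbb{C}^{n/2\times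 n}$ have entries $X_j(h,k)=\overline\zeta_h^{\,k-1}$ for $h\ne j$ and $X_j(j,k)=\overline z^{\,k-1}$, $k=1,\dots,n$; $\underline q_j=X_j\underline s$, $Q_j=X_jX_j^H$ (conjugate transpose), $\underline\mu_j=Q_j^{-1}\underline q_j$, $\nu_j=\underline s^H(I_n-X_j^H(X_jX_j^H)^{-1}X_j)\underline s$, $\tilde Q_j=\begin{bmatrix}\Re Q_j&-\Im Q_j\\ \Im Q_j&\Re Q_j\end{bmatrix}$, $D_j=\det(\tilde Q_j)$, $\Sigma_j=\frac{\sigma^2}{2}\tilde Q_j^{-1}$, and $\tilde{\underline\mu}_j\in\mathbb{R}^n$ the stacked real and imaginary parts of $\underline\mu_j$. All are defined for almost every $\underline\zeta^{(j)}$ (whenever $z$ and the $\zeta_h$ are pairwise distinct). The coefficients $\beta_k=\beta_k(\underline\zeta^{(j)},z)$, $k=0,\dots,n/2$ (which depend on $j$ and are independent of $\sigma$), are defined by the expansion in powers of $\sigma^2$ $$\mathbb{E}\Bigl[\prod_{i=1}^{n/2}\tilde{\underline\gamma}^TA_i\tilde{\underline\gamma}\Bigr]=\sum_{k=0}^{n/2}\beta_k(\underline\zeta^{(j)},z)\frac{\sigma^{2k}}{2^kD_j^{\,n-k}},\qquad \tilde{\underline\gamma}\sim N(\tilde{\underline\mu}_j,\Sigma_j),\quad A_i=I_2\otimes\underline e_i\underline e_i^T,$$ with $\underline e_i$ the standard basis of $\mathbb{R}^{n/2}$ (the left side is a polynomial of degree $n/2$ in $\sigma^2$). *)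

theory Defs
  imports
    "HOL-Probability.Probability"
    "Jordan_Normal_Form.Gauss_Jordan_Elimination"
    "Jordan_Normal_Form.Determinant"
    "Jordan_Normal_Form.Schur_Decomposition"
begin

text \<open>
  Indices are 0-based: with \<open>m = n div 2\<close>, the nodes \<open>\<zeta>\<close>, the amplitudes \<open>\<gamma>\<close> and the
  distinguished index \<open>j\<close> range over \<open>{..<m}\<close>, and the powers \<open>k\<close> over \<open>{..<n}\<close>.

  A vector of \<open>\<complex>\<^sup>m\<close> is identified with the vector of \<open>\<real>\<^sup>n\<close> that lists its real parts (coordinates
  \<open>0, \<dots>, m - 1\<close>) and then its imaginary parts (coordinates \<open>m, \<dots>, n - 1\<close>); leaving out the
  coordinates \<open>j\<close> and \<open>m + j\<close> gives \<open>\<complex>\<^bsup>m - 1\<^esup> = \<real>\<^bsup>n - 2\<^esup>\<close> for the nodes other than \<open>z\<close>.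
\<close>

definition real_space :: "nat set \<Rightarrow> (nat \<Rightarrow> real) measure" where
  "real_space I = (\<Pi>\<^sub>M i\<in>I. lborel)"

definition unstack :: "nat \<Rightarrow> (nat \<Rightarrow> real) \<Rightarrow> nat \<Rightarrow> complex" where
  "unstack m x = (\<lambda>h. Complex (x h) (x (m + h)))"

text \<open>Unspecified for singular matrices, which occur only for a null set of nodes.\<close>

definition minv :: "'a::field mat \<Rightarrow> 'a mat" where
  "minv A = the (mat_inverse A)"


subsection \<open>The density before integrating out the amplitudes\<close>

definition J_C :: "nat \<Rightarrow> nat \<Rightarrow> (nat \<Rightarrow> complex) \<Rightarrow> (nat \<Rightarrow> complex) \<Rightarrow> complex \<Rightarrow> complex" where
  "J_C n j \<gamma> \<zeta> z =
     (-1) ^ (n div 2) * (\<Prod>i<n div 2. \<gamma> i)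
     * (\<Prod>(r, h)\<in>{(r, h). r < h \<and> h < n div 2 \<and> r \<noteq> j \<and> h \<noteq> j}. (\<zeta> r - \<zeta> h) ^ 4)
     * (\<Prod>r\<in>{..<n div 2} - {j}. (\<zeta> r - z) ^ 4)"

definition h_density :: "nat \<Rightarrow> (nat \<Rightarrow> complex) \<Rightarrow> nat \<Rightarrow> complex \<Rightarrow> real \<Rightarrow> real" where
  "h_density n s j z \<sigma> =
     1 / (pi * \<sigma>\<^sup>2) ^ n *
     (LINT y|real_space ({..<n} - {j, n div 2 + j}). LINT x|real_space {..<n}.
        (let \<zeta> = unstack (n div 2) y; \<gamma> = unstack (n div 2) x in
          (cmod (J_C n j \<gamma> \<zeta> z))\<^sup>2 *
          exp (- (1 / \<sigma>\<^sup>2) *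
            (\<Sum>k<n. (cmod ((\<Sum>h\<in>{..<n div 2} - {j}. \<gamma> h * \<zeta> h ^ k) + \<gamma> j * z ^ k - s k))\<^sup>2))))"


subsection \<open>Matrices attached to the nodes\<close>

text \<open>
  In this section \<open>w\<close> is the full list of \<open>n div 2\<close> nodes; it is used with \<open>w = \<zeta>(j := z)\<close>.
\<close>

definition X_mat :: "nat \<Rightarrow> (nat \<Rightarrow> complex) \<Rightarrow> complex mat" where
  "X_mat n w = mat (n div 2) n (\<lambda>(h, k). cnj (w h) ^ k)"

definition Q_mat :: "nat \<Rightarrow> (nat \<Rightarrow> complex) \<Rightarrow> complex mat" where
  "Q_mat n w = X_mat n w * mat_adjoint (X_mat n w)"

definition q_vec :: "nat \<Rightarrow> (nat \<Rightarrow> complex) \<Rightarrow> (nat \<Rightarrow> complex) \<Rightarrow> complex vec" where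
  "q_vec n s w = X_mat n w *\<^sub>v vec n s"

definition mu_vec :: "nat \<Rightarrow> (nat \<Rightarrow> complex) \<Rightarrow> (nat \<Rightarrow> complex) \<Rightarrow> complex vec" where
  "mu_vec n s w = minv (Q_mat n w) *\<^sub>v q_vec n s w"

text \<open>
  \<open>u \<bullet>c v\<close> conjugates its second argument, so this is \<open>s\<^sup>H (I - X\<^sup>H (X X\<^sup>H)\<^sup>-\<^sup>1 X) s\<close>. That matrix is
  Hermitian, so the number is real and \<open>Re\<close> only changes its type.
\<close>

definition nu :: "nat \<Rightarrow> (nat \<Rightarrow> complex) \<Rightarrow> (nat \<Rightarrow> complex) \<Rightarrow> real" where
  "nu n s w =
     Re (((1\<^sub>m n - mat_adjoint (X_mat n w) * minv (X_mat n w * mat_adjoint (X_mat n w)) * X_mat n w)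
          *\<^sub>v vec n s) \<bullet>c vec n s)"

definition Q_real :: "nat \<Rightarrow> (nat \<Rightarrow> complex) \<Rightarrow> real mat" where
  "Q_real n w =
     four_block_mat (map_mat Re (Q_mat n w)) (- map_mat Im (Q_mat n w))
                    (map_mat Im (Q_mat n w)) (map_mat Re (Q_mat n w))"

definition D_det :: "nat \<Rightarrow> (nat \<Rightarrow> complex) \<Rightarrow> real" where
  "D_det n w = Determinant.det (Q_real n w)"

definition Sigma_mat :: "nat \<Rightarrow> (nat \<Rightarrow> complex) \<Rightarrow> real \<Rightarrow> real mat" where
  "Sigma_mat n w \<sigma> = (\<sigma>\<^sup>2 / 2) \<cdot>\<^sub>m minv (Q_real n w)"

definition mu_real :: "nat \<Rightarrow> (nat \<Rightarrow> complex) \<Rightarrow> (nat \<Rightarrow> complex) \<Rightarrow> real vec" where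
  "mu_real n s w = map_vec Re (mu_vec n s w) @\<^sub>v map_vec Im (mu_vec n s w)"


subsection \<open>Gaussian moments and the coefficients \<open>\<beta>\<^sub>k\<close>\<close>

text \<open>The normal distribution \<open>N(\<mu>, \<Sigma>)\<close> on \<open>\<real>\<^sup>d\<close>, for positive definite \<open>\<Sigma>\<close>.\<close>

definition normal_measure :: "nat \<Rightarrow> real vec \<Rightarrow> real mat \<Rightarrow> (nat \<Rightarrow> real) measure" where
  "normal_measure d \<mu> \<Sigma> =
     density (real_space {..<d})
       (\<lambda>x. ennreal (exp (- (1 / 2) * ((vec d x - \<mu>) \<bullet> (minv \<Sigma> *\<^sub>v (vec d x - \<mu>))))
                     / sqrt ((2 * pi) ^ d * Determinant.det \<Sigma>)))"

definition kronecker :: "'a::times mat \<Rightarrow> 'a mat \<Rightarrow> 'a mat" where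
  "kronecker A B =
     mat (dim_row A * dim_row B) (dim_col A * dim_col B)
       (\<lambda>(a, b). A $$ (a div dim_row B, b div dim_col B) * B $$ (a mod dim_row B, b mod dim_col B))"

definition A_mat :: "nat \<Rightarrow> nat \<Rightarrow> real mat" where
  "A_mat n i =
     kronecker (1\<^sub>m 2)
       (mat_of_cols (n div 2) [unit_vec (n div 2) i] * mat_of_rows (n div 2) [unit_vec (n div 2) i])"

definition gaussian_moment :: "nat \<Rightarrow> (nat \<Rightarrow> complex) \<Rightarrow> (nat \<Rightarrow> complex) \<Rightarrow> real \<Rightarrow> real" where
  "gaussian_moment n s w \<sigma> =
     (LINT x|normal_measure n (mu_real n s w) (Sigma_mat n w \<sigma>).
        (\<Prod>i<n div 2. vec n x \<bullet> (A_mat n i *\<^sub>v vec n x)))"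

text \<open>
  For pairwise distinct nodes the moment is a polynomial in \<open>\<sigma>\<^sup>2\<close> of degree \<open>n div 2\<close> and
  \<open>D \<noteq> 0\<close>, so the expansion for all \<open>\<sigma> > 0\<close> has exactly one solution on \<open>{..n div 2}\<close>.
\<close>

definition beta :: "nat \<Rightarrow> (nat \<Rightarrow> complex) \<Rightarrow> (nat \<Rightarrow> complex) \<Rightarrow> nat \<Rightarrow> real" where
  "beta n s w =
     (SOME b. \<forall>\<sigma>>0. gaussian_moment n s w \<sigma> =
        (\<Sum>k\<le>n div 2. b k * (\<sigma> ^ (2 * k) / (2 ^ k * D_det n w ^ (n - k)))))"

definition g_density ::
  "nat \<Rightarrow> (nat \<Rightarrow> complex) \<Rightarrow> nat \<Rightarrow> (nat \<Rightarrow> complex) \<Rightarrow> complex \<Rightarrow> real \<Rightarrow> real" where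
  "g_density n s j \<zeta> z \<sigma> =
     1 / (\<sigma> ^ n * pi ^ (n div 2)) *
     (\<Sum>k\<le>n div 2. \<sigma> ^ (2 * k) / 2 ^ k * beta n s (\<zeta>(j := z)) k *
        ((\<Prod>(r, h)\<in>{(r, h). r < h \<and> h < n div 2 \<and> r \<noteq> j \<and> h \<noteq> j}. cmod (\<zeta> r - \<zeta> h) ^ 8)
         * (\<Prod>r\<in>{..<n div 2} - {j}. cmod (\<zeta> r - z) ^ 8)
         / D_det n (\<zeta>(j := z)) powr (real n - real k + 1 / 2)))"

end

theory Submission
  imports Defs
begin

text \<open>
  The identity holds already between the integrands over the nodes: for every fixed \<open>\<zeta>\<close>, the integral
  over the amplitudes can be carried out in closed form.

  If two of the nodes \<open>w = \<zeta>(j := z)\<close> coincide, the factors \<open>(\<zeta>\<^sub>r - \<zeta>\<^sub>h)\<^sup>4\<close> and \<open>(\<zeta>\<^sub>r - z)\<^sup>4\<close> of the Jacobian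
  and their counterparts in \<open>g\<close> make both sides zero. So let the nodes be distinct. The exponent
  contains \<open>\<parallel>X\<^sup>H \<gamma> - s\<parallel>\<^sup>2\<close>, and completing the square around the least-squares solution \<open>\<mu>\<close> turns it into
  \<open>(\<gamma> - \<mu>)\<^sup>H Q (\<gamma> - \<mu>) + \<nu>\<close> (\<open>residual_completing_square\<close>). In real coordinates the first term is the
  exponent of the normal density \<open>N(\<mu>, \<Sigma>)\<close>, so the amplitude integral equals the moment
  \<open>E[\<Prod>\<bar>\<gamma>\<^sub>i\<bar>\<^sup>2]\<close> up to the normalising constant and the factor \<open>exp (- \<nu> / \<sigma>\<^sup>2)\<close>
  (\<open>amplitude_integral\<close>). Inserting the expansion that defines \<open>\<beta>\<^sub>k\<close> gives \<open>g\<close> (\<open>g_density_distinct\<close>).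

  What needs an argument is that this expansion exists. Put \<open>x = \<mu> + \<sigma> y\<close>; the moment becomes the
  integral of a polynomial in \<open>\<sigma>\<close> of degree at most \<open>n\<close>, with coefficients polynomial in \<open>y\<close>, against the fixed
  weight \<open>exp (- y\<^sup>T Q y)\<close>. The coefficients are integrable because \<open>Q\<close> is positive definite, which
  Lagrange interpolation at the nodes shows (\<open>amplitudes_from_signal\<close>, \<open>Q_real_coercive\<close>). Reflecting \<open>y\<close>
  changes the sign of \<open>\<sigma>\<close>, so only even powers of \<open>\<sigma>\<close> survive (\<open>gaussian_integral_poly\<close>).
\<close>

(* Below, v $ i is an entry of a vector whose dimension is a number, not a type. *)
unbundle no vec_syntax

section \<open>Complex matrices and their real forms\<close>

lemma mat_adjoint_carrier: "A \<in> carrier_mat m n \<Longrightarrow> mat_adjoint A \<in> carrier_mat n m"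
  unfolding mat_adjoint_def by auto

lemma mat_adjoint_index:
  fixes A :: "complex mat"
  shows "A \<in> carrier_mat m n \<Longrightarrow> i < n \<Longrightarrow> k < m \<Longrightarrow> mat_adjoint A $$ (i, k) = cnj (A $$ (k, i))"
  unfolding mat_adjoint_def by (auto simp: mat_of_rows_index)

lemma cscalar_prod_mult_mat_vec:
  fixes A :: "complex mat"
  assumes A: "A \<in> carrier_mat m n" and u: "u \<in> carrier_vec n" and v: "v \<in> carrier_vec m"
  shows "(A *\<^sub>v u) \<bullet>c v = u \<bullet>c (mat_adjoint A *\<^sub>v v)"
proof -
  note AH = mat_adjoint_carrier[OF A]
  have "(A *\<^sub>v u) \<bullet>c v = (\<Sum>k<m. \<Sum>i<n. A $$ (k, i) * u $ i * cnj (v $ k))"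
    using A u v by (auto simp: scalar_prod_def sum_distrib_right atLeast0LessThan)
  also have "\<dots> = (\<Sum>i<n. \<Sum>k<m. A $$ (k, i) * u $ i * cnj (v $ k))"
    by (rule sum.swap)
  also have "\<dots> = u \<bullet>c (mat_adjoint A *\<^sub>v v)"
    using A u v AH
    by (auto simp: scalar_prod_def sum_distrib_left atLeast0LessThan mat_adjoint_index[OF A]
        intro!: sum.cong)
  finally show ?thesis .
qed

lemma mat_adjoint_mult_cscalar_prod:
  fixes A :: "complex mat"
  assumes A: "A \<in> carrier_mat m n" and u: "u \<in> carrier_vec m" and v: "v \<in> carrier_vec n"
  shows "(mat_adjoint A *\<^sub>v u) \<bullet>c v = u \<bullet>c (A *\<^sub>v v)"
proof -
  note AH = mat_adjoint_carrier[OF A]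
  have "mat_adjoint (mat_adjoint A) = A"
    using A AH mat_adjoint_carrier[OF AH]
    by (intro eq_matI) (auto simp: mat_adjoint_index[OF AH] mat_adjoint_index[OF A])
  then show ?thesis using cscalar_prod_mult_mat_vec[OF AH u v] by simp
qed

lemma conjugate_minus_vec:
  fixes u v :: "complex vec"
  assumes "u \<in> carrier_vec n" "v \<in> carrier_vec n"
  shows "conjugate (u - v) = conjugate u - conjugate v"
  using assms by (intro eq_vecI) auto

text \<open>
  Here \<open>\<mu>\<close> is the least-squares solution of \<open>X\<^sup>H d = S\<close>: the residual \<open>r = S - X\<^sup>H \<mu>\<close> satisfies
  \<open>X r = 0\<close>, hence is orthogonal to the range of \<open>X\<^sup>H\<close>. As \<open>X\<^sup>H d - S = X\<^sup>H (d - \<mu>) - r\<close>, the identity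
  is Pythagoras' theorem, and \<open>r \<bullet>c r = r \<bullet>c S\<close> for the same reason.
\<close>

lemma least_squares_completing_square:
  fixes X B :: "complex mat" and m n
  defines "XH \<equiv> mat_adjoint X"
  assumes X: "X \<in> carrier_mat m n" and B: "B \<in> carrier_mat m m" and QB: "(X * XH) * B = 1\<^sub>m m"
    and S: "S \<in> carrier_vec n" and d: "d \<in> carrier_vec m"
  defines "\<mu> \<equiv> B *\<^sub>v (X *\<^sub>v S)"
  shows "(XH *\<^sub>v d - S) \<bullet>c (XH *\<^sub>v d - S)
     = ((X * XH) *\<^sub>v (d - \<mu>)) \<bullet>c (d - \<mu>) + ((1\<^sub>m n - XH * B * X) *\<^sub>v S) \<bullet>c S"
proof -
  have XH: "XH \<in> carrier_mat n m" unfolding XH_def using X by (rule mat_adjoint_carrier)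
  have mu: "\<mu> \<in> carrier_vec m" unfolding \<mu>_def using X B S by auto
  define a where "a = XH *\<^sub>v (d - \<mu>)"
  define r where "r = S - XH *\<^sub>v \<mu>"
  have a: "a \<in> carrier_vec n" and r: "r \<in> carrier_vec n"
    unfolding a_def r_def using XH mu S d
    by (auto intro!: mult_mat_vec_carrier[of _ n m])
  have r_eq: "(1\<^sub>m n - XH * B * X) *\<^sub>v S = r"
    unfolding r_def \<mu>_def using X XH B S
    by (simp add: minus_mult_distrib_mat_vec[of _ n n] assoc_mult_mat_vec[of _ n m _ n] assoc_mult_mat_vec[of _ n m _ m])
  have Xr: "X *\<^sub>v r = 0\<^sub>v m"
  proof -
    have "X *\<^sub>v (XH *\<^sub>v \<mu>) = ((X * XH) * B) *\<^sub>v (X *\<^sub>v S)"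
      unfolding \<mu>_def using X XH B S by (simp add: assoc_mult_mat_vec[of _ m m _ m] assoc_mult_mat_vec[of _ m n _ m])
    also have "\<dots> = X *\<^sub>v S" unfolding QB using X S by auto
    finally show ?thesis unfolding r_def using X XH S mu
      by (simp add: mult_minus_distrib_mat_vec[of _ m n])
  qed
  have split: "XH *\<^sub>v d - S = a - r"
    unfolding a_def r_def using XH mu S d
    by (simp add: mult_minus_distrib_mat_vec[of _ n m]) auto
  have ar: "a \<bullet>c r = 0"
    unfolding a_def XH_def using mat_adjoint_mult_cscalar_prod[OF X _ r, of "d - \<mu>"] d mu Xr by simp
  have ra: "r \<bullet>c a = 0"
    unfolding a_def XH_def using cscalar_prod_mult_mat_vec[OF X r, of "d - \<mu>"] d mu Xr by simp
  have rr: "r \<bullet>c r = r \<bullet>c S"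
  proof -
    have "r \<bullet>c (XH *\<^sub>v \<mu>) = (X *\<^sub>v r) \<bullet>c \<mu>"
      unfolding XH_def using cscalar_prod_mult_mat_vec[OF X r mu] by simp
    also have "\<dots> = 0" using Xr mu by simp
    finally have 0: "r \<bullet>c (XH *\<^sub>v \<mu>) = 0" .
    have "r \<bullet>c r = r \<bullet>c (S - XH *\<^sub>v \<mu>)" by (simp add: r_def)
    also have "\<dots> = r \<bullet>c S - r \<bullet>c (XH *\<^sub>v \<mu>)"
      using r S XH mu by (simp add: conjugate_minus_vec[of _ n] scalar_prod_minus_distrib[of _ n])
    finally show ?thesis using 0 by simp
  qed
  have aa: "a \<bullet>c a = ((X * XH) *\<^sub>v (d - \<mu>)) \<bullet>c (d - \<mu>)"
    using mat_adjoint_mult_cscalar_prod[OF X _ a, of "d - \<mu>"] cscalar_prod_mult_mat_vec[OF X a, of "d - \<mu>"]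
      X XH d mu unfolding a_def XH_def by (simp add: assoc_mult_mat_vec[of _ m n _ m])
  have "(a - r) \<bullet>c (a - r) = a \<bullet>c a - a \<bullet>c r - (r \<bullet>c a - r \<bullet>c r)"
    using a r by (simp add: conjugate_minus_vec[of _ n] scalar_prod_minus_distrib[of _ n]
        minus_scalar_prod_distrib[of _ n])
  then show ?thesis unfolding split r_eq ar ra rr aa by simp
qed

lemma minv_left_right:
  fixes A :: "'a::field mat"
  assumes A: "A \<in> carrier_mat n n" and det: "Determinant.det A \<noteq> 0"
  shows "minv A \<in> carrier_mat n n" "A * minv A = 1\<^sub>m n" "minv A * A = 1\<^sub>m n"
proof -
  obtain B where "mat_inverse A = Some B"
    using mat_inverse(1)[OF A, of undefined] det_non_zero_imp_unit[OF A det, of undefined] by fastforce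
  then show "minv A \<in> carrier_mat n n" "A * minv A = 1\<^sub>m n" "minv A * A = 1\<^sub>m n"
    using mat_inverse(2)[OF A] by (auto simp: minv_def)
qed

lemma minv_eqI:
  fixes A :: "'a::field mat"
  assumes A: "A \<in> carrier_mat n n" and B: "B \<in> carrier_mat n n" and AB: "A * B = 1\<^sub>m n"
  shows "minv A = B"
proof -
  have "Determinant.det A * Determinant.det B = 1"
    using arg_cong[OF AB, of Determinant.det] det_mult[OF A B] by simp
  then have det: "Determinant.det A \<noteq> 0" by auto
  note i = minv_left_right[OF A det]
  have "minv A = minv A * (A * B)" using i AB by simp
  also have "\<dots> = B" using i A B by (simp add: assoc_mult_mat[of _ n n _ n _ n, symmetric])
  finally show ?thesis .
qed

text \<open>
  The matrix of the real-linear map \<open>d \<mapsto> A d\<close> in the coordinates that list all real parts before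
  all imaginary parts.
\<close>

definition realify :: "complex mat \<Rightarrow> real mat" where
  "realify A = four_block_mat (map_mat Re A) (- map_mat Im A) (map_mat Im A) (map_mat Re A)"

text \<open>
  Over the complex numbers, conjugating \<open>realify A\<close> by the block matrix with rows \<open>(1, \<i>)\<close> and \<open>(0, 1)\<close>
  makes it block triangular, with \<open>A\<close> and its entrywise conjugate on the diagonal.
\<close>

lemma det_realify:
  assumes A: "A \<in> carrier_mat m m"
  shows "Determinant.det (realify A) = (cmod (Determinant.det A))\<^sup>2"
proof -
  let ?r = complex_of_real
  define P where "P = map_mat ?r (map_mat Re A)"
  define R where "R = map_mat ?r (map_mat Im A)"
  have P: "P \<in> carrier_mat m m" and R: "R \<in> carrier_mat m m" unfolding P_def R_def using A by auto
  define L where "L = four_block_mat (1\<^sub>m m) (\<i> \<cdot>\<^sub>m 1\<^sub>m m) (0\<^sub>m m m) (1\<^sub>m m)"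
  define U where "U = four_block_mat (1\<^sub>m m) (- \<i> \<cdot>\<^sub>m 1\<^sub>m m) (0\<^sub>m m m) (1\<^sub>m m)"
  define M where "M = map_mat ?r (realify A)"
  have M_eq: "M = four_block_mat P (- R) R P"
    unfolding M_def realify_def P_def R_def using A by (auto intro!: eq_matI)
  have M: "M \<in> carrier_mat (m+m) (m+m)" unfolding M_eq using P R by auto
  have LU: "L \<in> carrier_mat (m+m) (m+m)" "U \<in> carrier_mat (m+m) (m+m)" unfolding L_def U_def by auto
  have PR: "P + \<i> \<cdot>\<^sub>m R = A" unfolding P_def R_def using A by (auto intro!: eq_matI simp: complex_eq_iff)
  have PR': "P + - \<i> \<cdot>\<^sub>m R = map_mat cnj A" unfolding P_def R_def using A
    by (auto intro!: eq_matI simp: complex_eq_iff)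
  have LM: "L * M = four_block_mat A (\<i> \<cdot>\<^sub>m A) R P"
  proof -
    have "L * M = four_block_mat (P + \<i> \<cdot>\<^sub>m R) (- R + \<i> \<cdot>\<^sub>m P) R P"
      unfolding L_def M_eq using P R
      by (subst mult_four_block_mat[of _ m m _ m _ m]) (auto simp: mult_smult_assoc_mat[of _ m m _ m])
    also have "- R + \<i> \<cdot>\<^sub>m P = \<i> \<cdot>\<^sub>m A"
      unfolding PR[symmetric] using P R by (auto intro!: eq_matI simp: algebra_simps)
    finally show ?thesis unfolding PR .
  qed
  have LMU: "L * M * U = four_block_mat A (0\<^sub>m m m) R (map_mat cnj A)"
  proof -
    have "L * M * U = four_block_mat A (- \<i> \<cdot>\<^sub>m A + \<i> \<cdot>\<^sub>m A) R (- \<i> \<cdot>\<^sub>m R + P)"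
      unfolding LM U_def using A P R
      by (subst mult_four_block_mat[of _ m m _ m _ m]) (auto simp: mult_smult_distrib[of _ m m _ m])
    also have "- \<i> \<cdot>\<^sub>m A + \<i> \<cdot>\<^sub>m A = 0\<^sub>m m m" using A by (auto intro!: eq_matI)
    also have "- \<i> \<cdot>\<^sub>m R + P = map_mat cnj A"
      unfolding PR'[symmetric] using P R by (auto intro!: eq_matI)
    finally show ?thesis .
  qed
  have dL: "Determinant.det L = 1" "Determinant.det U = 1"
    unfolding L_def U_def by (subst det_four_block_mat_lower_left_zero[of _ m]; auto)+
  have cnj_hom: "Determinant.det (map_mat cnj A) = cnj (Determinant.det A)"
  proof -
    interpret c: comm_ring_hom cnj by standard auto
    show ?thesis by simp
  qed
  have "Determinant.det (L * M * U) = Determinant.det M"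
    using M LU dL by (simp add: det_mult[of _ "m+m"])
  moreover have "Determinant.det (L * M * U) = Determinant.det A * cnj (Determinant.det A)"
    unfolding LMU using A R by (subst det_four_block_mat_upper_right_zero[of _ m]) (auto simp: cnj_hom)
  moreover have "Determinant.det M = ?r (Determinant.det (realify A))"
    unfolding M_def by (rule of_real_hom.hom_det)
  ultimately have "?r (Determinant.det (realify A)) = ?r ((cmod (Determinant.det A))\<^sup>2)"
    by (simp only: complex_norm_square)
  then show ?thesis by (simp only: of_real_eq_iff)
qed

lemma realify_quadratic_form:
  assumes A: "A \<in> carrier_mat m m" and d: "d \<in> carrier_vec m"
  defines "r \<equiv> map_vec Re d @\<^sub>v map_vec Im d"
  shows "r \<bullet> (realify A *\<^sub>v r) = Re ((A *\<^sub>v d) \<bullet>c d)"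
proof -
  have Re: "map_mat Re A *\<^sub>v map_vec Re d + (- map_mat Im A) *\<^sub>v map_vec Im d = map_vec Re (A *\<^sub>v d)"
    using A d by (intro eq_vecI) (auto simp: scalar_prod_def sum_subtractf sum_negf)
  have Im: "map_mat Im A *\<^sub>v map_vec Re d + map_mat Re A *\<^sub>v map_vec Im d = map_vec Im (A *\<^sub>v d)"
    using A d by (intro eq_vecI) (auto simp: scalar_prod_def sum.distrib add.commute)
  have "realify A *\<^sub>v r = map_vec Re (A *\<^sub>v d) @\<^sub>v map_vec Im (A *\<^sub>v d)"
    unfolding realify_def r_def Re[symmetric] Im[symmetric] using A d
    by (intro four_block_mat_mult_vec[of _ m m _ m _ m]) auto
  then have "r \<bullet> (realify A *\<^sub>v r) = r \<bullet> (map_vec Re (A *\<^sub>v d) @\<^sub>v map_vec Im (A *\<^sub>v d))"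
    by simp
  also have "\<dots> = map_vec Re d \<bullet> map_vec Re (A *\<^sub>v d) + map_vec Im d \<bullet> map_vec Im (A *\<^sub>v d)"
    unfolding r_def using A d by (intro scalar_prod_append[of _ m _ m]) auto
  also have "\<dots> = (\<Sum>i<m. Re ((A *\<^sub>v d) $ i * cnj (d $ i)))"
    using A d by (simp add: scalar_prod_def sum.distrib atLeast0LessThan mult.commute del: index_mult_mat_vec)
  also have "\<dots> = Re ((A *\<^sub>v d) \<bullet>c d)"
    using A d by (simp add: scalar_prod_def atLeast0LessThan del: index_mult_mat_vec)
  finally show ?thesis .
qed

lemma smult_mat_mult_vec:
  fixes A :: "'a::comm_ring mat"
  assumes "A \<in> carrier_mat m n" "v \<in> carrier_vec n"
  shows "(c \<cdot>\<^sub>m A) *\<^sub>v v = c \<cdot>\<^sub>v (A *\<^sub>v v)"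
  using assms by (intro eq_vecI) (auto simp: scalar_prod_def sum_distrib_left mult.assoc)

section \<open>Vandermonde systems and the matrix of the normal equations\<close>

definition signal :: "nat \<Rightarrow> (nat \<Rightarrow> complex) \<Rightarrow> (nat \<Rightarrow> complex) \<Rightarrow> nat \<Rightarrow> complex" where
  "signal m w \<gamma> k = (\<Sum>h<m. \<gamma> h * w h ^ k)"

text \<open>
  The row \<open>L h\<close> consists of the coefficients of the Lagrange polynomial that is 1 at \<open>w h\<close> and 0 at
  the other nodes: pairing it with the powers of \<open>w i\<close> evaluates that polynomial at \<open>w i\<close>. This left
  inverse of the Vandermonde matrix gives both that \<open>Q\<close> is nonsingular and that its quadratic form is
  bounded below.
\<close>

lemma amplitudes_from_signal:
  fixes w :: "nat \<Rightarrow> complex"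
  assumes inj: "inj_on w {..<m}" and mn: "m \<le> n"
  obtains L where "\<And>\<gamma> h. h < m \<Longrightarrow> \<gamma> h = (\<Sum>k<n. L h k * signal m w \<gamma> k)"
proof -
  define l where "l h = (\<Prod>i\<in>{..<m} - {h}. Polynomial.smult (1 / (w h - w i)) [:- w i, 1:])" for h
  have deg: "degree (l h) < n" if "h < m" for h
  proof -
    have factor: "degree (Polynomial.smult a [:b, 1:]) \<le> 1" for a b :: complex
      by (rule order.trans[OF degree_smult_le]) simp
    have "degree (l h) \<le> (\<Sum>i\<in>{..<m} - {h}. degree (Polynomial.smult (1 / (w h - w i)) [:- w i, 1:]))"
      unfolding l_def by (rule order.trans[OF degree_prod_sum_le])
        (simp_all only: o_def order.refl finite_Diff finite_lessThan)
    also have "\<dots> \<le> (\<Sum>i\<in>{..<m} - {h}. 1)" by (intro sum_mono factor)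
    also have "\<dots> = m - 1" using that by simp
    finally show ?thesis using that mn by linarith
  qed
  have val: "poly (l h) (w i) = (if i = h then 1 else 0)" if "h < m" "i < m" for h i
  proof (cases "i = h")
    case True
    have "poly (l h) (w h) = (\<Prod>i\<in>{..<m} - {h}. 1)"
      unfolding l_def poly_prod
    proof (rule prod.cong)
      fix i assume "i \<in> {..<m} - {h}"
      then have "w h \<noteq> w i" using inj_onD[OF inj, of h i] that by auto
      then show "poly (Polynomial.smult (1 / (w h - w i)) [:- w i, 1:]) (w h) = 1"
        by (simp add: diff_divide_distrib[symmetric])
    qed simp
    then show ?thesis using True by simp
  next
    case False
    then show ?thesis unfolding l_def poly_prod using that by auto
  qed
  show thesis
  proof
    fix \<gamma> :: "nat \<Rightarrow> complex" and h assume h: "h < m"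
    have "(\<Sum>k<n. coeff (l h) k * signal m w \<gamma> k) = (\<Sum>k<n. \<Sum>i<m. \<gamma> i * (coeff (l h) k * w i ^ k))"
      by (simp add: signal_def sum_distrib_left mult_ac)
    also have "\<dots> = (\<Sum>i<m. \<gamma> i * (\<Sum>k<n. coeff (l h) k * w i ^ k))"
      by (subst sum.swap) (simp add: sum_distrib_left)
    also have "\<dots> = (\<Sum>i<m. \<gamma> i * poly (l h) (w i))"
    proof (rule sum.cong)
      fix i
      have "poly (l h) (w i) = (\<Sum>k<n. coeff (l h) k * w i ^ k)"
        unfolding poly_altdef using deg[OF h] coeff_eq_0[of "l h"]
        by (intro sum.mono_neutral_left) auto
      then show "\<gamma> i * (\<Sum>k<n. coeff (l h) k * w i ^ k) = \<gamma> i * poly (l h) (w i)" by simp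
    qed simp
    also have "\<dots> = (\<Sum>i<m. if i = h then \<gamma> i else 0)"
      using h by (intro sum.cong) (simp_all add: val)
    also have "\<dots> = \<gamma> h" using h by simp
    finally show "\<gamma> h = (\<Sum>k<n. coeff (l h) k * signal m w \<gamma> k)" ..
  qed
qed

lemma X_mat_carrier: "X_mat n w \<in> carrier_mat (n div 2) n"
  unfolding X_mat_def by simp

lemma X_mat_adjoint_mult:
  "mat_adjoint (X_mat n w) *\<^sub>v vec (n div 2) \<gamma> = vec n (signal (n div 2) w \<gamma>)"
proof -
  have XH: "mat_adjoint (X_mat n w) $$ (k, h) = w h ^ k" if "k < n" "h < n div 2" for k h
    using mat_adjoint_index[OF X_mat_carrier that, of w] that by (simp add: X_mat_def)
  show ?thesis
    using mat_adjoint_carrier[OF X_mat_carrier, of n w]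
    by (intro eq_vecI)
      (auto simp: scalar_prod_def signal_def atLeast0LessThan XH mult.commute intro!: sum.cong)
qed

lemma Q_mat_carrier: "Q_mat n w \<in> carrier_mat (n div 2) (n div 2)"
  unfolding Q_mat_def using X_mat_carrier[of n w] mat_adjoint_carrier[OF X_mat_carrier, of n w] by simp

lemma cscalar_prod_self_vec:
  fixes e :: "nat \<Rightarrow> complex"
  shows "vec n e \<bullet>c vec n e = of_real (\<Sum>k<n. (cmod (e k))\<^sup>2)"
  by (auto simp: scalar_prod_def atLeast0LessThan complex_norm_square simp del: of_real_power intro!: sum.cong)

lemma Q_mat_hermitian_form:
  "(Q_mat n w *\<^sub>v vec (n div 2) \<gamma>) \<bullet>c vec (n div 2) \<gamma>
     = of_real (\<Sum>k<n. (cmod (signal (n div 2) w \<gamma> k))\<^sup>2)"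
proof -
  let ?X = "X_mat n w"
  note X = X_mat_carrier[of n w] and XH = mat_adjoint_carrier[OF X_mat_carrier, of n w]
  have "(Q_mat n w *\<^sub>v vec (n div 2) \<gamma>) \<bullet>c vec (n div 2) \<gamma>
      = (?X *\<^sub>v vec n (signal (n div 2) w \<gamma>)) \<bullet>c vec (n div 2) \<gamma>"
    unfolding Q_mat_def X_mat_adjoint_mult[symmetric] using X XH
    by (simp add: assoc_mult_mat_vec[of _ "n div 2" n _ "n div 2"])
  also have "\<dots> = of_real (\<Sum>k<n. (cmod (signal (n div 2) w \<gamma> k))\<^sup>2)"
    using cscalar_prod_mult_mat_vec[OF X, of "vec n (signal (n div 2) w \<gamma>)" "vec (n div 2) \<gamma>"]
    by (simp add: X_mat_adjoint_mult cscalar_prod_self_vec)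
  finally show ?thesis .
qed

lemma Q_real_eq_realify: "Q_real n w = realify (Q_mat n w)"
  unfolding Q_real_def realify_def ..

lemma stack_unstack:
  assumes "even n"
  shows "map_vec Re (vec (n div 2) (unstack (n div 2) x)) @\<^sub>v map_vec Im (vec (n div 2) (unstack (n div 2) x))
    = vec n x"
  using assms by (intro eq_vecI) (auto simp: unstack_def elim!: evenE)

lemma Q_real_quadratic_form:
  assumes "even n"
  shows "vec n x \<bullet> (Q_real n w *\<^sub>v vec n x)
    = (\<Sum>k<n. (cmod (signal (n div 2) w (unstack (n div 2) x) k))\<^sup>2)"
  unfolding Q_real_eq_realify stack_unstack[OF assms, symmetric]
  by (subst realify_quadratic_form[OF Q_mat_carrier]) (auto simp: Q_mat_hermitian_form)

text \<open>
  A vector in the kernel of \<open>Q\<close> has vanishing signal, and the signal determines the amplitudes.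
\<close>

lemma Q_mat_det_nonzero:
  assumes inj: "inj_on w {..<n div 2}"
  shows "Determinant.det (Q_mat n w) \<noteq> 0"
proof
  assume "Determinant.det (Q_mat n w) = 0"
  then obtain v where v: "v \<in> carrier_vec (n div 2)" "v \<noteq> 0\<^sub>v (n div 2)"
    "Q_mat n w *\<^sub>v v = 0\<^sub>v (n div 2)"
    unfolding det_0_iff_vec_prod_zero_field[OF Q_mat_carrier] by blast
  define \<gamma> where "\<gamma> h = v $ h" for h
  have v_eq: "v = vec (n div 2) \<gamma>" using v(1) by (auto simp: \<gamma>_def)
  obtain L where L: "\<And>\<gamma> h. h < n div 2 \<Longrightarrow> \<gamma> h = (\<Sum>k<n. L h k * signal (n div 2) w \<gamma> k)"
    using amplitudes_from_signal[OF inj, of n] by (metis div_le_dividend)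
  have "complex_of_real (\<Sum>k<n. (cmod (signal (n div 2) w \<gamma> k))\<^sup>2) = 0"
    using Q_mat_hermitian_form[of n w \<gamma>] v(1,3) unfolding v_eq by simp
  then have "(\<Sum>k<n. (cmod (signal (n div 2) w \<gamma> k))\<^sup>2) = 0" unfolding of_real_eq_0_iff .
  then have "signal (n div 2) w \<gamma> k = 0" if "k < n" for k
    using that by (subst (asm) sum_nonneg_eq_0_iff) auto
  then have "\<gamma> h = 0" if "h < n div 2" for h using L[OF that, of \<gamma>] by simp
  then show False using v(2) unfolding v_eq by auto
qed

text \<open>
  Positivity, not only invertibility, is what the square root of \<open>D\<close> in the normal density needs.
\<close>

lemma D_det_pos: "inj_on w {..<n div 2} \<Longrightarrow> D_det n w > 0"
  unfolding D_det_def Q_real_eq_realify det_realify[OF Q_mat_carrier]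
  using Q_mat_det_nonzero[of w n] by simp

lemma Q_real_carrier: "even n \<Longrightarrow> Q_real n w \<in> carrier_mat n n"
  unfolding Q_real_def using Q_mat_carrier[of n w] by (auto elim!: evenE)

text \<open>
  Each amplitude is a fixed linear combination of the signal values, so Cauchy and Schwarz bound its
  square by a constant times the quadratic form.
\<close>

lemma Q_real_coercive:
  assumes "even n" and inj: "inj_on w {..<n div 2}"
  obtains c where "c > 0" "\<And>x. c * (\<Sum>i<n. (x i)\<^sup>2) \<le> vec n x \<bullet> (Q_real n w *\<^sub>v vec n x)"
proof -
  define m where "m = n div 2"
  have n: "n = m + m" using assms(1) unfolding m_def by auto
  obtain L where L: "\<And>\<gamma> h. h < m \<Longrightarrow> \<gamma> h = (\<Sum>k<n. L h k * signal m w \<gamma> k)"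
    using amplitudes_from_signal[OF inj, of n] unfolding m_def by (metis div_le_dividend)
  define K where "K = 1 + (\<Sum>h<m. \<Sum>k<n. (cmod (L h k))\<^sup>2)"
  have K: "K > 0" unfolding K_def by (smt (verit) sum_nonneg zero_le_power2)
  show thesis
  proof
    show "1 / K > 0" using K by simp
    fix x :: "nat \<Rightarrow> real"
    let ?e = "\<lambda>k. cmod (signal m w (unstack m x) k)"
    have bound: "(cmod (unstack m x h))\<^sup>2 \<le> (\<Sum>k<n. (cmod (L h k))\<^sup>2) * (\<Sum>k<n. (?e k)\<^sup>2)" if "h < m" for h
    proof -
      have "cmod (unstack m x h) = cmod (\<Sum>k<n. L h k * signal m w (unstack m x) k)"
        using L[OF that, of "unstack m x"] by simp
      also have "\<dots> \<le> (\<Sum>k<n. cmod (L h k) * ?e k)"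
        by (rule order.trans[OF norm_sum]) (simp add: norm_mult)
      finally have "(cmod (unstack m x h))\<^sup>2 \<le> (\<Sum>k<n. cmod (L h k) * ?e k)\<^sup>2"
        by (rule power_mono) simp
      also have "\<dots> \<le> (\<Sum>k<n. (cmod (L h k))\<^sup>2) * (\<Sum>k<n. (?e k)\<^sup>2)"
        by (rule Cauchy_Schwarz_ineq_sum)
      finally show ?thesis .
    qed
    have "(\<Sum>i<n. (x i)\<^sup>2) = (\<Sum>h<m. (cmod (unstack m x h))\<^sup>2)"
    proof -
      have "{..<n} = {..<m} \<union> {m..<m+m}" unfolding n by auto
      then have "(\<Sum>i<n. (x i)\<^sup>2) = (\<Sum>i<m. (x i)\<^sup>2) + (\<Sum>i=m..<m+m. (x i)\<^sup>2)"
        by (simp add: sum.union_disjoint ivl_disj_int)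
      also have "(\<Sum>i=m..<m+m. (x i)\<^sup>2) = (\<Sum>i<m. (x (m+i))\<^sup>2)"
        using sum.shift_bounds_nat_ivl[of "\<lambda>i. (x i)\<^sup>2" 0 m m] by (simp add: atLeast0LessThan add.commute)
      finally show ?thesis by (simp add: unstack_def cmod_def sum.distrib)
    qed
    also have "\<dots> \<le> (\<Sum>h<m. (\<Sum>k<n. (cmod (L h k))\<^sup>2) * (\<Sum>k<n. (?e k)\<^sup>2))"
      using bound by (intro sum_mono) auto
    also have "\<dots> \<le> K * (\<Sum>k<n. (?e k)\<^sup>2)"
      unfolding sum_distrib_right[symmetric] K_def by (intro mult_right_mono sum_nonneg) auto
    finally show "1 / K * (\<Sum>i<n. (x i)\<^sup>2) \<le> vec n x \<bullet> (Q_real n w *\<^sub>v vec n x)"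
      unfolding Q_real_quadratic_form[OF assms(1)] m_def[symmetric] using K by (simp add: field_simps)
  qed
qed

text \<open>
  Least squares for \<open>X\<^sup>H \<gamma> = s\<close>, read in the real coordinates in which the amplitudes are integrated:
  \<open>nu\<close> is the minimal squared residual and does not involve \<open>x\<close>.
\<close>

lemma residual_completing_square:
  assumes n: "even n" and inj: "inj_on w {..<n div 2}"
  shows "(\<Sum>k<n. (cmod (signal (n div 2) w (unstack (n div 2) x) k - s k))\<^sup>2)
    = (vec n x - mu_real n s w) \<bullet> (Q_real n w *\<^sub>v (vec n x - mu_real n s w)) + nu n s w"
proof -
  let ?m = "n div 2"
  let ?X = "X_mat n w" and ?d = "vec ?m (unstack ?m x)" and ?S = "vec n s"
  let ?B = "minv (Q_mat n w)"
  note X = X_mat_carrier[of n w]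
  note B = minv_left_right[OF Q_mat_carrier Q_mat_det_nonzero[OF inj]]
  have mu: "mu_vec n s w = ?B *\<^sub>v (?X *\<^sub>v ?S)" unfolding mu_vec_def q_vec_def ..
  have mu_c: "mu_vec n s w \<in> carrier_vec ?m" unfolding mu using B(1) X by auto
  have Xd: "mat_adjoint ?X *\<^sub>v ?d - ?S = vec n (\<lambda>k. signal ?m w (unstack ?m x) k - s k)"
    unfolding X_mat_adjoint_mult by auto
  have eq: "complex_of_real (\<Sum>k<n. (cmod (signal ?m w (unstack ?m x) k - s k))\<^sup>2)
      = (Q_mat n w *\<^sub>v (?d - mu_vec n s w)) \<bullet>c (?d - mu_vec n s w)
        + ((1\<^sub>m n - mat_adjoint ?X * ?B * ?X) *\<^sub>v ?S) \<bullet>c ?S"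
    using least_squares_completing_square[OF X B(1), of ?S ?d] B(2)
    unfolding Q_mat_def mu Xd cscalar_prod_self_vec by simp
  have stack: "vec n x - mu_real n s w
      = map_vec Re (?d - mu_vec n s w) @\<^sub>v map_vec Im (?d - mu_vec n s w)"
  proof -
    have "vec n x - mu_real n s w = (map_vec Re ?d @\<^sub>v map_vec Im ?d) - mu_real n s w"
      using stack_unstack[OF n] by simp
    also have "\<dots> = map_vec Re (?d - mu_vec n s w) @\<^sub>v map_vec Im (?d - mu_vec n s w)"
      unfolding mu_real_def using mu_c by (intro eq_vecI) auto
    finally show ?thesis .
  qed
  have "(vec n x - mu_real n s w) \<bullet> (Q_real n w *\<^sub>v (vec n x - mu_real n s w))
      = Re ((Q_mat n w *\<^sub>v (?d - mu_vec n s w)) \<bullet>c (?d - mu_vec n s w))"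
    unfolding stack Q_real_eq_realify using mu_c
    by (intro realify_quadratic_form[OF Q_mat_carrier]) auto
  then show ?thesis
    using arg_cong[OF eq, of Re] unfolding nu_def Q_mat_def[symmetric] by simp
qed

lemma mu_real_carrier:
  assumes n: "even n" and inj: "inj_on w {..<n div 2}"
  shows "mu_real n s w \<in> carrier_vec n"
proof -
  have "mu_vec n s w \<in> carrier_vec (n div 2)"
    unfolding mu_vec_def q_vec_def
    using minv_left_right(1)[OF Q_mat_carrier Q_mat_det_nonzero[OF inj]] X_mat_carrier[of n w] by simp
  then show ?thesis unfolding mu_real_def using n by (intro carrier_vecI) auto
qed

section \<open>Lebesgue integrals against Gaussian weights\<close>

lemma measurable_real_space_coordinate:
  "i \<in> I \<Longrightarrow> (\<lambda>x. x i) \<in> borel_measurable (real_space I)"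
  unfolding real_space_def by measurable

text \<open>
  The product of the measures \<open>\<bar>c\<bar> \<cdot> distr lborel borel (\<lambda>x. t i + c * x)\<close>, which are all
  Lebesgue measure on the line, agrees with Lebesgue measure on boxes, and boxes determine it.
\<close>

lemma real_space_affine:
  fixes f :: "(nat \<Rightarrow> real) \<Rightarrow> real"
  assumes [simp]: "finite I" and c: "c \<noteq> 0" and f[measurable]: "f \<in> borel_measurable (real_space I)"
  shows "(LINT x|real_space I. f x)
         = \<bar>c\<bar> ^ card I * (LINT x|real_space I. f (\<lambda>i\<in>I. t i + c * x i))"
proof -
  define T where "T = (\<lambda>x::nat\<Rightarrow>real. \<lambda>i\<in>I. t i + c * x i)"
  define M where "M = (\<Pi>\<^sub>M i\<in>I. (lborel::real measure))"
  have T[measurable]: "T \<in> M \<rightarrow>\<^sub>M M" unfolding T_def M_def by measurable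
  interpret product_sigma_finite "\<lambda>_::nat. lborel::real measure" by standard
  have M_eq: "density (distr M M T) (\<lambda>_. ennreal (\<bar>c\<bar> ^ card I)) = M"
    unfolding M_def
  proof (rule PiM_eqI)
    fix A :: "nat \<Rightarrow> real set" assume A: "\<And>i. i \<in> I \<Longrightarrow> A i \<in> sets lborel"
    let ?B = "\<lambda>i. (\<lambda>x. t i + c * x) -` A i"
    have B: "?B i \<in> sets lborel" if "i \<in> I" for i
      using measurable_sets[of "\<lambda>x. t i + c * x" lborel lborel "A i"] A[OF that] by simp
    have AE: "Pi\<^sub>E I A \<in> sets M" unfolding M_def using A by (intro sets_PiM_I_finite) auto
    have vim: "T -` (Pi\<^sub>E I A) \<inter> space M = Pi\<^sub>E I ?B"
      unfolding M_def T_def by (auto simp: space_PiM PiE_iff extensional_def)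
    have box: "emeasure lborel (A i) = ennreal \<bar>c\<bar> * emeasure lborel (?B i)" if "i \<in> I" for i
      using A[OF that] by (subst lborel_real_affine[OF c, of "t i"])
        (simp add: emeasure_density nn_integral_cmult emeasure_distr)
    have "emeasure (density (distr M M T) (\<lambda>_. ennreal (\<bar>c\<bar> ^ card I))) (Pi\<^sub>E I A)
        = ennreal (\<bar>c\<bar> ^ card I) * emeasure M (Pi\<^sub>E I ?B)"
      using AE by (simp add: emeasure_density nn_integral_cmult emeasure_distr vim)
    also have "emeasure M (Pi\<^sub>E I ?B) = (\<Prod>i\<in>I. emeasure lborel (?B i))"
      unfolding M_def using B by (intro emeasure_PiM) auto
    also have "ennreal (\<bar>c\<bar> ^ card I) * \<dots> = (\<Prod>i\<in>I. ennreal \<bar>c\<bar> * emeasure lborel (?B i))"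
      by (simp add: prod.distrib ennreal_power)
    also have "\<dots> = (\<Prod>i\<in>I. emeasure lborel (A i))" using box by simp
    finally show "emeasure (density (distr (PiM I (\<lambda>_. lborel)) (PiM I (\<lambda>_. lborel)) T) (\<lambda>_. ennreal (\<bar>c\<bar> ^ card I))) (Pi\<^sub>E I A)
      = (\<Prod>i\<in>I. emeasure lborel (A i))" unfolding M_def .
  qed simp_all
  have f': "f \<in> borel_measurable M" using f unfolding real_space_def M_def .
  have "(\<integral>x. f x \<partial>M) = (\<integral>x. f x \<partial>density (distr M M T) (\<lambda>_. ennreal (\<bar>c\<bar> ^ card I)))"
    by (simp add: M_eq)
  also have "\<dots> = \<bar>c\<bar> ^ card I * (\<integral>x. f (T x) \<partial>M)"
    using f' by (simp add: integral_density integral_distr)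
  finally show ?thesis unfolding M_def T_def real_space_def .
qed

lemma quadratic_form_expand:
  fixes A :: "real mat"
  assumes "A \<in> carrier_mat n n" "v \<in> carrier_vec n"
  shows "v \<bullet> (A *\<^sub>v v) = (\<Sum>i<n. v $ i * (\<Sum>k<n. A $$ (i, k) * v $ k))"
  using assms by (auto simp: scalar_prod_def atLeast0LessThan intro!: sum.cong)

lemma measurable_quadratic_form:
  fixes A :: "real mat"
  assumes A: "A \<in> carrier_mat n n" and mu: "\<mu> \<in> carrier_vec n"
  shows "(\<lambda>x. (vec n x - \<mu>) \<bullet> (A *\<^sub>v (vec n x - \<mu>))) \<in> borel_measurable (real_space {..<n})"
proof -
  have eq: "(vec n x - \<mu>) \<bullet> (A *\<^sub>v (vec n x - \<mu>))
      = (\<Sum>i<n. (x i - \<mu> $ i) * (\<Sum>k<n. A $$ (i, k) * (x k - \<mu> $ k)))" for x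
    using mu by (subst quadratic_form_expand[OF A]) (auto intro!: sum.cong)
  show ?thesis unfolding eq
    by (intro borel_measurable_sum borel_measurable_times borel_measurable_diff measurable_real_space_coordinate borel_measurable_const) auto
qed

text \<open>
  Growth so slow that multiplying by any centred Gaussian factor, however wide, leaves an integrable
  function. Unlike polynomials of a given degree, this class is closed under products without any
  bookkeeping: split \<open>\<epsilon>\<close> in halves.
\<close>

definition subgaussian_growth :: "nat set \<Rightarrow> ((nat \<Rightarrow> real) \<Rightarrow> real) \<Rightarrow> bool" where
  "subgaussian_growth I f \<longleftrightarrow> f \<in> borel_measurable (real_space I) \<and>
     (\<forall>\<epsilon>>0. \<exists>K\<ge>0. \<forall>x. \<bar>f x\<bar> \<le> K * exp (\<epsilon> * (\<Sum>i\<in>I. (x i)\<^sup>2)))"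

lemma subgaussian_growth_const: "subgaussian_growth I (\<lambda>x. a)"
  unfolding subgaussian_growth_def
proof (intro conjI allI impI)
  fix \<epsilon> :: real assume "\<epsilon> > 0"
  then have "\<bar>a\<bar> * 1 \<le> \<bar>a\<bar> * exp (\<epsilon> * (\<Sum>i\<in>I. (x i)\<^sup>2))" for x :: "nat \<Rightarrow> real"
    by (intro mult_left_mono) (auto intro!: mult_nonneg_nonneg sum_nonneg)
  then show "\<exists>K\<ge>0. \<forall>x. \<bar>a\<bar> \<le> K * exp (\<epsilon> * (\<Sum>i\<in>I. (x i)\<^sup>2))"
    by (intro exI[of _ "\<bar>a\<bar>"]) auto
qed simp

lemma subgaussian_growth_coordinate:
  assumes "finite I" and i: "i \<in> I"
  shows "subgaussian_growth I (\<lambda>x. x i)"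
  unfolding subgaussian_growth_def
proof (intro conjI allI impI)
  show "(\<lambda>x. x i) \<in> borel_measurable (real_space I)"
    using i by (rule measurable_real_space_coordinate)
  fix \<epsilon> :: real assume e: "\<epsilon> > 0"
  have "\<bar>x i\<bar> \<le> (1 + 1 / \<epsilon>) * exp (\<epsilon> * (\<Sum>i\<in>I. (x i)\<^sup>2))" for x :: "nat \<Rightarrow> real"
  proof -
    let ?E = "exp (\<epsilon> * (\<Sum>i\<in>I. (x i)\<^sup>2))"
    have le: "(x i)\<^sup>2 \<le> (\<Sum>i\<in>I. (x i)\<^sup>2)" using assms by (intro member_le_sum) auto
    have "\<epsilon> * (x i)\<^sup>2 \<le> \<epsilon> * (\<Sum>i\<in>I. (x i)\<^sup>2)" using e le by simp
    also have "\<dots> \<le> ?E" using exp_ge_add_one_self[of "\<epsilon> * (\<Sum>i\<in>I. (x i)\<^sup>2)"] by linarith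
    finally have 1: "(x i)\<^sup>2 \<le> 1 / \<epsilon> * ?E" using e by (simp add: field_simps)
    have 2: "1 \<le> ?E" using e by (auto intro!: mult_nonneg_nonneg sum_nonneg)
    have "\<bar>x i\<bar> \<le> 1 + (x i)\<^sup>2"
    proof (cases "\<bar>x i\<bar> \<le> 1")
      case False
      then have "\<bar>x i\<bar> * 1 \<le> \<bar>x i\<bar> * \<bar>x i\<bar>" by (intro mult_left_mono) auto
      then show ?thesis by (simp add: power2_eq_square)
    qed (simp add: add_increasing2)
    with 1 2 have "\<bar>x i\<bar> \<le> ?E + 1 / \<epsilon> * ?E" by linarith
    then show ?thesis by (simp add: distrib_right)
  qed
  then show "\<exists>K\<ge>0. \<forall>x. \<bar>x i\<bar> \<le> K * exp (\<epsilon> * (\<Sum>i\<in>I. (x i)\<^sup>2))"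
    using e by (intro exI[of _ "1 + 1 / \<epsilon>"]) auto
qed

lemma subgaussian_growth_add:
  assumes f: "subgaussian_growth I f" and g: "subgaussian_growth I g"
  shows "subgaussian_growth I (\<lambda>x. f x + g x)"
  unfolding subgaussian_growth_def
proof (intro conjI allI impI)
  show "(\<lambda>x. f x + g x) \<in> borel_measurable (real_space I)"
    using f g by (auto simp: subgaussian_growth_def)
  fix \<epsilon> :: real assume "\<epsilon> > 0"
  then obtain K K' where K: "K \<ge> 0" "K' \<ge> 0"
    and f': "\<And>x. \<bar>f x\<bar> \<le> K * exp (\<epsilon> * (\<Sum>i\<in>I. (x i)\<^sup>2))"
    and g': "\<And>x. \<bar>g x\<bar> \<le> K' * exp (\<epsilon> * (\<Sum>i\<in>I. (x i)\<^sup>2))"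
    using f g unfolding subgaussian_growth_def by metis
  have "\<bar>f x + g x\<bar> \<le> (K + K') * exp (\<epsilon> * (\<Sum>i\<in>I. (x i)\<^sup>2))" for x
    using f'[of x] g'[of x] by (simp add: distrib_right)
  then show "\<exists>K\<ge>0. \<forall>x. \<bar>f x + g x\<bar> \<le> K * exp (\<epsilon> * (\<Sum>i\<in>I. (x i)\<^sup>2))"
    using K by (intro exI[of _ "K + K'"]) auto
qed

lemma subgaussian_growth_mult:
  assumes f: "subgaussian_growth I f" and g: "subgaussian_growth I g"
  shows "subgaussian_growth I (\<lambda>x. f x * g x)"
  unfolding subgaussian_growth_def
proof (intro conjI allI impI)
  show "(\<lambda>x. f x * g x) \<in> borel_measurable (real_space I)"
    using f g by (auto simp: subgaussian_growth_def)
  fix \<epsilon> :: real assume "\<epsilon> > 0"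
  then have "\<epsilon> / 2 > 0" by simp
  then obtain K K' where K: "K \<ge> 0" "K' \<ge> 0"
    and f': "\<And>x. \<bar>f x\<bar> \<le> K * exp (\<epsilon> / 2 * (\<Sum>i\<in>I. (x i)\<^sup>2))"
    and g': "\<And>x. \<bar>g x\<bar> \<le> K' * exp (\<epsilon> / 2 * (\<Sum>i\<in>I. (x i)\<^sup>2))"
    using f g unfolding subgaussian_growth_def by metis
  have "\<bar>f x * g x\<bar> \<le> (K * K') * exp (\<epsilon> * (\<Sum>i\<in>I. (x i)\<^sup>2))" for x
  proof -
    let ?S = "\<Sum>i\<in>I. (x i)\<^sup>2"
    have "\<bar>f x * g x\<bar> \<le> (K * exp (\<epsilon> / 2 * ?S)) * (K' * exp (\<epsilon> / 2 * ?S))"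
      unfolding abs_mult using f'[of x] g'[of x] K by (intro mult_mono) auto
    also have "\<dots> = (K * K') * exp (\<epsilon> / 2 * ?S + \<epsilon> / 2 * ?S)" by (simp only: exp_add mult_ac)
    also have "\<epsilon> / 2 * ?S + \<epsilon> / 2 * ?S = \<epsilon> * ?S" by simp
    finally show ?thesis .
  qed
  then show "\<exists>K\<ge>0. \<forall>x. \<bar>f x * g x\<bar> \<le> K * exp (\<epsilon> * (\<Sum>i\<in>I. (x i)\<^sup>2))"
    using K by (intro exI[of _ "K * K'"]) auto
qed

lemma subgaussian_growth_sum:
  "(\<And>a. a \<in> A \<Longrightarrow> subgaussian_growth I (f a)) \<Longrightarrow> subgaussian_growth I (\<lambda>x. \<Sum>a\<in>A. f a x)"
  by (induction A rule: infinite_finite_induct) (auto intro: subgaussian_growth_const subgaussian_growth_add)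

text \<open>
  Half of the quadratic lower bound on \<open>q\<close> absorbs the growth of \<open>f\<close>; the other half leaves a product of
  one-dimensional Gaussians as an integrable majorant.
\<close>

lemma integrable_subgaussian_growth_times_gaussian:
  fixes f q :: "(nat \<Rightarrow> real) \<Rightarrow> real"
  assumes I: "finite I" and c: "c > 0" and q[measurable]: "q \<in> borel_measurable (real_space I)"
    and qc: "\<And>x::nat \<Rightarrow> real. c * (\<Sum>i\<in>I. (x i)\<^sup>2) \<le> q x" and f: "subgaussian_growth I f"
  shows "integrable (real_space I) (\<lambda>x. f x * exp (- q x))"
proof -
  have "c / 2 > 0" using c by simp
  then obtain K where K: "K \<ge> 0" "\<And>x::nat \<Rightarrow> real. \<bar>f x\<bar> \<le> K * exp (c / 2 * (\<Sum>i\<in>I. (x i)\<^sup>2))"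
    using f unfolding subgaussian_growth_def by metis
  have [measurable]: "f \<in> borel_measurable (real_space I)" using f by (simp add: subgaussian_growth_def)
  interpret product_sigma_finite "\<lambda>_::nat. lborel::real measure" by standard
  have "integrable lborel (\<lambda>x. sqrt (2 * pi / c) * normal_density 0 (1 / sqrt c) x)"
    using c by (intro integrable_mult_right integrable_normal_density) simp
  \<comment> \<open>A centred normal density of variance \<open>1 / c\<close>, with its normalising constant removed.\<close>
  also have "(\<lambda>x. sqrt (2 * pi / c) * normal_density 0 (1 / sqrt c) x) = (\<lambda>x. exp (- (c / 2 * x\<^sup>2)))"
    using c by (auto simp: normal_density_def fun_eq_iff power_divide real_sqrt_divide)
  finally have "integrable (real_space I) (\<lambda>x. \<Prod>i\<in>I. exp (- (c / 2 * (x i)\<^sup>2)))"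
    unfolding real_space_def using I by (intro product_integrable_prod)
  then have "integrable (real_space I) (\<lambda>x. K * (\<Prod>i\<in>I. exp (- (c / 2 * (x i)\<^sup>2))))"
    by simp
  then show ?thesis
  proof (rule Bochner_Integration.integrable_bound)
    show "AE x in real_space I. norm (f x * exp (- q x)) \<le> norm (K * (\<Prod>i\<in>I. exp (- (c / 2 * (x i)\<^sup>2))))"
    proof (intro AE_I2)
      fix x :: "nat \<Rightarrow> real"
      let ?S = "\<Sum>i\<in>I. (x i)\<^sup>2"
      have "\<bar>f x\<bar> * exp (- q x) \<le> (K * exp (c / 2 * ?S)) * exp (- (c * ?S))"
        using K(2)[of x] qc[of x] K(1) by (intro mult_mono) auto
      also have "\<dots> = K * exp (c / 2 * ?S + - (c * ?S))" unfolding exp_add by simp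
      also have "c / 2 * ?S + - (c * ?S) = (\<Sum>i\<in>I. - (c / 2 * (x i)\<^sup>2))"
        by (simp add: sum_distrib_left sum_negf[symmetric] sum.distrib[symmetric])
      also have "K * exp \<dots> = K * (\<Prod>i\<in>I. exp (- (c / 2 * (x i)\<^sup>2)))" using I by (simp add: exp_sum)
      finally show "norm (f x * exp (- q x)) \<le> norm (K * (\<Prod>i\<in>I. exp (- (c / 2 * (x i)\<^sup>2))))"
        using K(1) by (simp add: abs_mult prod_nonneg)
    qed
  qed measurable
qed

section \<open>Gaussian moments as even polynomials in the noise level\<close>

lemma sum_even_indices:
  fixes g :: "nat \<Rightarrow> real"
  assumes "\<And>k. odd k \<Longrightarrow> g k = 0"
  shows "(\<Sum>k\<le>2 * m. g k) = (\<Sum>k\<le>m. g (2 * k))"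
  using assms by (induction m) auto

text \<open>
  The product of the squared moduli of the amplitudes along the line \<open>\<sigma> \<mapsto> t + \<sigma> y\<close>, as a polynomial
  in \<open>\<sigma>\<close>. Treating it as a formal polynomial gives its coefficients as functions of \<open>y\<close>.
\<close>

definition line_poly :: "nat \<Rightarrow> (nat \<Rightarrow> real) \<Rightarrow> (nat \<Rightarrow> real) \<Rightarrow> real poly" where
  "line_poly m t y = (\<Prod>i<m. [:t i, y i:]\<^sup>2 + [:t (m + i), y (m + i):]\<^sup>2)"

lemma poly_line_poly:
  "poly (line_poly m t y) \<sigma> = (\<Prod>i<m. (t i + \<sigma> * y i)\<^sup>2 + (t (m + i) + \<sigma> * y (m + i))\<^sup>2)"
  by (simp add: line_poly_def poly_prod)

lemma degree_line_poly: "degree (line_poly m t y) \<le> 2 * m"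
proof -
  have "degree (line_poly m t y) \<le> (\<Sum>i<m. 2)"
    unfolding line_poly_def
  proof (rule order.trans[OF degree_prod_sum_le])
    have "degree ([:t i, y i:]\<^sup>2 + [:t (m + i), y (m + i):]\<^sup>2) \<le> 2" for i
      by (intro degree_add_le order.trans[OF degree_power_le]) auto
    then show "sum (degree \<circ> (\<lambda>i. [:t i, y i:]\<^sup>2 + [:t (m + i), y (m + i):]\<^sup>2)) {..<m} \<le> (\<Sum>i<m. 2)"
      unfolding o_def by (intro sum_mono)
  qed simp
  then show ?thesis by simp
qed

lemma subgaussian_growth_coeff_mult:
  assumes "\<And>k. subgaussian_growth I (\<lambda>y. coeff (p y) k)" "\<And>k. subgaussian_growth I (\<lambda>y. coeff (r y) k)"
  shows "subgaussian_growth I (\<lambda>y. coeff (p y * r y) k)"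
  unfolding coeff_mult by (intro subgaussian_growth_sum subgaussian_growth_mult assms)

lemma subgaussian_growth_coeff_line_poly:
  "subgaussian_growth {..<m + m} (\<lambda>y. coeff (line_poly m t y) k)"
proof -
  have lin: "subgaussian_growth {..<m + m} (\<lambda>y. coeff [:t j, y j:] k)" if "j < m + m" for j k
    using that subgaussian_growth_coordinate[of "{..<m + m}" j] subgaussian_growth_const
    by (cases k; cases "k - 1") (auto simp: coeff_pCons split: nat.splits)
  have fac: "subgaussian_growth {..<m + m} (\<lambda>y. coeff ([:t i, y i:]\<^sup>2 + [:t (m + i), y (m + i):]\<^sup>2) k)"
    if "i < m" for i k
    unfolding coeff_add power2_eq_square
    by (intro subgaussian_growth_add subgaussian_growth_coeff_mult lin) (use that in auto)
  have "subgaussian_growth {..<m + m} (\<lambda>y. coeff (\<Prod>i\<in>A. [:t i, y i:]\<^sup>2 + [:t (m + i), y (m + i):]\<^sup>2) k)"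
    if "finite A" "A \<subseteq> {..<m}" for A k
    using that
  proof (induction A arbitrary: k)
    case empty
    show ?case using subgaussian_growth_const by (simp add: coeff_1)
  next
    case (insert a A)
    then show ?case by (simp del: coeff_add) (intro subgaussian_growth_coeff_mult fac, auto)
  qed
  then show ?thesis unfolding line_poly_def by simp
qed

text \<open>
  Integrating the coefficients of \<open>line_poly\<close> one by one yields a polynomial in \<open>\<sigma>\<close> of degree at most
  \<open>2 m\<close>. The reflection \<open>y \<mapsto> - y\<close> preserves the weight and changes \<open>\<sigma>\<close> into \<open>- \<sigma>\<close>, so the polynomial is
  even, and averaging its values at \<open>\<sigma>\<close> and \<open>- \<sigma>\<close> removes the odd powers.
\<close>

lemma gaussian_integral_poly:
  fixes q :: "(nat \<Rightarrow> real) \<Rightarrow> real" and t :: "nat \<Rightarrow> real"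
  assumes c: "c > 0" and q: "q \<in> borel_measurable (real_space {..<m + m})"
    and qc: "\<And>x::nat \<Rightarrow> real. c * (\<Sum>i<m + m. (x i)\<^sup>2) \<le> q x"
    and even: "\<And>x. q (\<lambda>i\<in>{..<m + m}. - x i) = q x"
  obtains e :: "nat \<Rightarrow> real" where
    "\<And>\<sigma>. (LINT y|real_space {..<m + m}. poly (line_poly m t y) \<sigma> * exp (- q y)) = (\<Sum>k\<le>m. e k * \<sigma> ^ (2 * k))"
proof -
  let ?M = "real_space {..<m + m}"
  define H where "H \<sigma> = (LINT y|?M. poly (line_poly m t y) \<sigma> * exp (- q y))" for \<sigma>
  define a where "a k = (LINT y|?M. coeff (line_poly m t y) k * exp (- q y))" for k
  have int: "integrable ?M (\<lambda>y. coeff (line_poly m t y) k * exp (- q y))" for k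
    by (rule integrable_subgaussian_growth_times_gaussian[OF _ c q qc subgaussian_growth_coeff_line_poly]) auto
  have expand: "poly (line_poly m t y) \<sigma> * exp (- q y)
      = (\<Sum>k\<le>2 * m. \<sigma> ^ k * (coeff (line_poly m t y) k * exp (- q y)))" for y \<sigma>
  proof -
    have "poly (line_poly m t y) \<sigma> = (\<Sum>k\<le>2 * m. coeff (line_poly m t y) k * \<sigma> ^ k)"
      unfolding poly_altdef using degree_line_poly[of m t y] coeff_eq_0[of "line_poly m t y"]
      by (intro sum.mono_neutral_left) auto
    then show ?thesis by (simp add: sum_distrib_left mult_ac)
  qed
  have H: "H \<sigma> = (\<Sum>k\<le>2 * m. \<sigma> ^ k * a k)" for \<sigma>
    unfolding H_def expand a_def using int by (subst Bochner_Integration.integral_sum) auto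
  have meas: "(\<lambda>y. poly (line_poly m t y) \<sigma> * exp (- q y)) \<in> borel_measurable ?M" for \<sigma>
    unfolding expand by (intro borel_measurable_sum borel_measurable_times borel_measurable_integrable[OF int] borel_measurable_const)
  have H_even: "H (- \<sigma>) = H \<sigma>" for \<sigma>
  proof -
    have "H \<sigma> = (LINT y|?M. poly (line_poly m t (\<lambda>i\<in>{..<m + m}. - y i)) \<sigma> * exp (- q (\<lambda>i\<in>{..<m + m}. - y i)))"
      unfolding H_def using real_space_affine[OF _ _ meas[of \<sigma>], of "-1" "\<lambda>_. 0"] by simp
    also have "\<dots> = H (- \<sigma>)"
      unfolding H_def even by (auto simp: poly_line_poly intro!: Bochner_Integration.integral_cong)
    finally show ?thesis ..
  qed
  have "H \<sigma> = (\<Sum>k\<le>m. a (2 * k) * \<sigma> ^ (2 * k))" for \<sigma>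
  proof -
    have "2 * H \<sigma> = (\<Sum>k\<le>2 * m. \<sigma> ^ k * a k) + (\<Sum>k\<le>2 * m. (- \<sigma>) ^ k * a k)"
      using H_even[of \<sigma>] H[of \<sigma>] H[of "- \<sigma>"] by linarith
    also have "\<dots> = (\<Sum>k\<le>2 * m. \<sigma> ^ k * a k + (- \<sigma>) ^ k * a k)"
      by (rule sum.distrib[symmetric])
    also have "\<dots> = (\<Sum>k\<le>m. \<sigma> ^ (2 * k) * a (2 * k) + (- \<sigma>) ^ (2 * k) * a (2 * k))"
      by (rule sum_even_indices) simp
    also have "\<dots> = 2 * (\<Sum>k\<le>m. a (2 * k) * \<sigma> ^ (2 * k))"
      by (simp add: sum_distrib_left mult_ac)
    finally show ?thesis by simp
  qed
  then show thesis using that[of "\<lambda>k. a (2 * k)"] unfolding H_def by blast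
qed

lemma A_mat_form:
  assumes n: "even n" and i: "i < n div 2"
  shows "vec n x \<bullet> (A_mat n i *\<^sub>v vec n x) = (x i)\<^sup>2 + (x (n div 2 + i))\<^sup>2"
proof -
  define m where "m = n div 2"
  have nm: "n = 2 * m" using n unfolding m_def by auto
  have i: "i < m" using i unfolding m_def .
  \<comment> \<open>\<open>A_mat n i\<close> is diagonal, with ones at the coordinates of the real and imaginary part of \<open>\<gamma> i\<close>.\<close>
  have entry: "A_mat n i $$ (a, b) = (if a = b \<and> (a = i \<or> a = m + i) then 1 else 0)"
    if "a < n" "b < n" for a b
  proof -
    have ab: "a div m < 2" "b div m < 2" "a mod m < m" "b mod m < m"
      using that i unfolding nm by (auto simp: less_mult_imp_div_less)
    have "A_mat n i $$ (a, b) = (if a div m = b div m then 1 else 0)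
        * ((if a mod m = i then 1 else 0) * (if b mod m = i then 1 else 0))"
      unfolding A_mat_def kronecker_def m_def[symmetric] using that ab i
      by (simp add: nm mat_of_cols_def mat_of_rows_def scalar_prod_def)
    also have "\<dots> = (if a = b \<and> (a = i \<or> a = m + i) then 1 else 0)"
    proof -
      have "a = b" if "a div m = b div m" "a mod m = i" "b mod m = i"
        using that by (metis div_mult_mod_eq)
      moreover have "a = i \<or> a = m + i" if "a mod m = i"
      proof -
        have "a div m = 0 \<or> a div m = 1" using ab by auto
        then show ?thesis using div_mult_mod_eq[of a m] that by auto
      qed
      moreover have "i mod m = i" "(m + i) mod m = i" using i by auto
      ultimately show ?thesis by auto
    qed
    finally show ?thesis .
  qed
  have A: "A_mat n i \<in> carrier_mat n n"
    unfolding A_mat_def kronecker_def m_def[symmetric] by (simp add: nm mat_of_cols_def mat_of_rows_def)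
  have "vec n x \<bullet> (A_mat n i *\<^sub>v vec n x)
      = (\<Sum>a<n. x a * (\<Sum>b<n. A_mat n i $$ (a, b) * x b))"
    by (subst quadratic_form_expand[OF A]) auto
  also have "\<dots> = (\<Sum>a<n. if a = i \<or> a = m + i then (x a)\<^sup>2 else 0)"
  proof (rule sum.cong)
    fix a assume "a \<in> {..<n}"
    then have "(\<Sum>b<n. A_mat n i $$ (a, b) * x b)
        = (\<Sum>b<n. if b = a then (if a = i \<or> a = m + i then x b else 0) else 0)"
      by (intro sum.cong) (auto simp: entry)
    also have "\<dots> = (if a = i \<or> a = m + i then x a else 0)"
      using \<open>a \<in> {..<n}\<close> by simp
    finally show "x a * (\<Sum>b<n. A_mat n i $$ (a, b) * x b) = (if a = i \<or> a = m + i then (x a)\<^sup>2 else 0)"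
      by (simp add: power2_eq_square)
  qed simp
  also have "\<dots> = (\<Sum>a\<in>{i, m + i}. (x a)\<^sup>2)"
    using i nm by (intro sum.mono_neutral_cong_right) auto
  also have "\<dots> = (x i)\<^sup>2 + (x (m + i))\<^sup>2" using i by simp
  finally show ?thesis unfolding m_def .
qed

text \<open>
  Since \<open>\<Sigma>\<^sup>-\<^sup>1 = (2 / \<sigma>\<^sup>2) \<cdot> Q\<close> and \<open>det \<Sigma> = (\<sigma>\<^sup>2 / 2)\<^sup>n / D\<close> for the real matrix \<open>Q\<close> of size \<open>n\<close>, the
  normalising constant of the density is \<open>sqrt D / (\<pi>\<^sup>m \<sigma>\<^sup>n)\<close> with \<open>m = n / 2\<close>.
\<close>

lemma gaussian_moment_eq:
  assumes n: "even n" and inj: "inj_on w {..<n div 2}" and \<sigma>: "\<sigma> > 0"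
  shows "gaussian_moment n s w \<sigma> = sqrt (D_det n w) / (pi ^ (n div 2) * \<sigma> ^ n)
    * (LINT x|real_space {..<n}. (\<Prod>i<n div 2. (x i)\<^sup>2 + (x (n div 2 + i))\<^sup>2)
        * exp (- (1 / \<sigma>\<^sup>2) * ((vec n x - mu_real n s w) \<bullet> (Q_real n w *\<^sub>v (vec n x - mu_real n s w)))))"
proof -
  define D where "D = D_det n w"
  define q where "q x = (vec n x - mu_real n s w) \<bullet> (Q_real n w *\<^sub>v (vec n x - mu_real n s w))" for x
  define F where "F x = (\<Prod>i<n div 2. (x i)\<^sup>2 + (x (n div 2 + i))\<^sup>2)" for x :: "nat \<Rightarrow> real"
  have D: "D > 0" unfolding D_def by (rule D_det_pos[OF inj])
  note Q = Q_real_carrier[OF n, of w]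
  have iQ: "minv (Q_real n w) \<in> carrier_mat n n" "minv (Q_real n w) * Q_real n w = 1\<^sub>m n"
    "Q_real n w * minv (Q_real n w) = 1\<^sub>m n"
    using minv_left_right[OF Q] D unfolding D_def D_det_def by auto
  have Sigma_inv: "minv (Sigma_mat n w \<sigma>) = (2 / \<sigma>\<^sup>2) \<cdot>\<^sub>m Q_real n w"
    unfolding Sigma_mat_def
  proof (rule minv_eqI)
    show "(\<sigma>\<^sup>2 / 2) \<cdot>\<^sub>m minv (Q_real n w) * ((2 / \<sigma>\<^sup>2) \<cdot>\<^sub>m Q_real n w) = 1\<^sub>m n"
    proof -
      have "(\<sigma>\<^sup>2 / 2) \<cdot>\<^sub>m minv (Q_real n w) * ((2 / \<sigma>\<^sup>2) \<cdot>\<^sub>m Q_real n w) = (2 / \<sigma>\<^sup>2) \<cdot>\<^sub>m ((\<sigma>\<^sup>2 / 2) \<cdot>\<^sub>m 1\<^sub>m n)"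
        using iQ Q by (simp add: mult_smult_assoc_mat[of _ n n _ n] mult_smult_distrib[of _ n n _ n])
      also have "\<dots> = 1\<^sub>m n" using \<sigma> by (intro eq_matI) auto
      finally show ?thesis .
    qed
  qed (use iQ Q in auto)
  have "Determinant.det (minv (Q_real n w)) * D = 1"
    using arg_cong[OF iQ(2), of Determinant.det] det_mult[OF iQ(1) Q] unfolding D_def D_det_def by simp
  then have "Determinant.det (minv (Q_real n w)) = 1 / D" using D by (simp add: field_simps)
  then have Sigma_det: "Determinant.det (Sigma_mat n w \<sigma>) = (\<sigma>\<^sup>2 / 2) ^ n / D"
    unfolding Sigma_mat_def using iQ(1) by simp
  have norm: "sqrt ((2 * pi) ^ n * Determinant.det (Sigma_mat n w \<sigma>)) = pi ^ (n div 2) * \<sigma> ^ n / sqrt D"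
  proof -
    have sq: "(2 * pi) ^ n * ((\<sigma>\<^sup>2 / 2) ^ n / D) = (pi ^ (n div 2) * \<sigma> ^ n)\<^sup>2 / D"
      using n by (auto simp: power_mult_distrib power_divide power_mult[symmetric] mult.commute elim!: evenE)
    show ?thesis unfolding Sigma_det sq using \<sigma> by (simp add: real_sqrt_divide)
  qed
  have expo: "(1 / 2) * ((vec n x - mu_real n s w) \<bullet> (minv (Sigma_mat n w \<sigma>) *\<^sub>v (vec n x - mu_real n s w)))
      = (1 / \<sigma>\<^sup>2) * q x" for x
  proof -
    have v: "vec n x - mu_real n s w \<in> carrier_vec n" using mu_real_carrier[OF n inj] by auto
    show ?thesis unfolding Sigma_inv q_def using Q v
      by (simp add: smult_mat_mult_vec[OF Q v] scalar_prod_smult_distrib[of _ n])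
  qed
  have q_meas: "q \<in> borel_measurable (real_space {..<n})"
    unfolding q_def using measurable_quadratic_form[OF Q mu_real_carrier[OF n inj]] .
  have F_meas: "F \<in> borel_measurable (real_space {..<n})"
    unfolding F_def by (intro borel_measurable_prod borel_measurable_add borel_measurable_power measurable_real_space_coordinate) auto
  let ?\<rho> = "\<lambda>x. exp (- (1 / \<sigma>\<^sup>2 * q x)) / (pi ^ (n div 2) * \<sigma> ^ n / sqrt D)"
  have "gaussian_moment n s w \<sigma> = (LINT x|density (real_space {..<n}) (\<lambda>x. ennreal (?\<rho> x)). F x)"
    unfolding gaussian_moment_def normal_measure_def norm F_def mult_minus_left expo
    by (simp add: A_mat_form[OF n])
  also have "\<dots> = (LINT x|real_space {..<n}. ?\<rho> x *\<^sub>R F x)"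
    using F_meas q_meas D \<sigma> by (intro integral_density) (auto intro!: AE_I2 divide_nonneg_nonneg)
  also have "\<dots> = (LINT x|real_space {..<n}. sqrt D / (pi ^ (n div 2) * \<sigma> ^ n) * (F x * exp (- (1 / \<sigma>\<^sup>2) * q x)))"
    by (intro Bochner_Integration.integral_cong) auto
  finally show ?thesis unfolding F_def q_def D_def by simp
qed

text \<open>
  The substitution \<open>x = \<mu> + \<sigma> y\<close> removes \<open>\<sigma>\<close> from the exponent, and its Jacobian \<open>\<sigma>\<^sup>n\<close> cancels against
  the normalising constant. What remains depends on \<open>\<sigma>\<close> through \<open>line_poly\<close> alone.
\<close>

lemma gaussian_moment_even_polynomial:
  assumes n: "even n" and inj: "inj_on w {..<n div 2}"
  obtains e :: "nat \<Rightarrow> real" where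
    "\<And>\<sigma>. \<sigma> > 0 \<Longrightarrow> gaussian_moment n s w \<sigma> = (\<Sum>k\<le>n div 2. e k * \<sigma> ^ (2 * k))"
proof -
  define m where "m = n div 2"
  have nm: "m + m = n" using n unfolding m_def by auto
  define t where "t i = mu_real n s w $ i" for i
  define q where "q x = vec n x \<bullet> (Q_real n w *\<^sub>v vec n x)" for x
  let ?M = "real_space {..<n}"
  note Q = Q_real_carrier[OF n, of w]
  note mu = mu_real_carrier[OF n inj, of s]
  obtain c where c: "c > 0" "\<And>x. c * (\<Sum>i<n. (x i)\<^sup>2) \<le> q x"
    using Q_real_coercive[OF n inj] unfolding q_def by blast
  have q_scale: "q (\<lambda>i\<in>{..<n}. a * x i) = a\<^sup>2 * q x" for a x
    unfolding q_def
    by (simp add: quadratic_form_expand[OF Q] sum_distrib_left power2_eq_square mult_ac)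
  have q_meas: "q \<in> borel_measurable ?M"
  proof -
    have "vec n x - 0\<^sub>v n = vec n x" for x :: "nat \<Rightarrow> real" by auto
    then show ?thesis using measurable_quadratic_form[OF Q, of "0\<^sub>v n"] unfolding q_def by simp
  qed
  obtain e where e: "\<And>\<sigma>. (LINT y|?M. poly (line_poly m t y) \<sigma> * exp (- q y)) = (\<Sum>k\<le>m. e k * \<sigma> ^ (2 * k))"
    using gaussian_integral_poly[of c q m t] c q_meas q_scale[of "-1"] unfolding nm by auto
  have "gaussian_moment n s w \<sigma> = sqrt (D_det n w) / pi ^ m * (\<Sum>k\<le>m. e k * \<sigma> ^ (2 * k))" if \<sigma>: "\<sigma> > 0" for \<sigma>
  proof -
    let ?q = "\<lambda>x. (vec n x - mu_real n s w) \<bullet> (Q_real n w *\<^sub>v (vec n x - mu_real n s w))"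
    define f where "f x = (\<Prod>i<m. (x i)\<^sup>2 + (x (m + i))\<^sup>2) * exp (- (1 / \<sigma>\<^sup>2) * ?q x)" for x
    have f_meas: "f \<in> borel_measurable ?M"
      unfolding f_def
      by (intro borel_measurable_times borel_measurable_prod borel_measurable_add borel_measurable_power
          measurable_real_space_coordinate
          measurable_compose[OF _ borel_measurable_exp] measurable_quadratic_form[OF Q mu] borel_measurable_const)
        (auto simp: nm[symmetric])
    have shifted: "f (\<lambda>i\<in>{..<n}. t i + \<sigma> * y i) = poly (line_poly m t y) \<sigma> * exp (- q y)" for y
    proof -
      have "vec n (\<lambda>i\<in>{..<n}. t i + \<sigma> * y i) - mu_real n s w = vec n (\<lambda>i\<in>{..<n}. \<sigma> * y i)"
        using mu by (intro eq_vecI) (auto simp: t_def)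
      then have "?q (\<lambda>i\<in>{..<n}. t i + \<sigma> * y i) = \<sigma>\<^sup>2 * q y"
        using q_scale[of \<sigma> y] unfolding q_def by simp
      then show ?thesis using \<sigma> unfolding f_def poly_line_poly by (simp add: nm[symmetric])
    qed
    have "(LINT x|?M. f x) = \<sigma> ^ n * (LINT y|?M. poly (line_poly m t y) \<sigma> * exp (- q y))"
      using real_space_affine[OF _ _ f_meas, of \<sigma> t] \<sigma> by (simp add: shifted)
    then show ?thesis
      using gaussian_moment_eq[OF n inj \<sigma>, of s] \<sigma>
      unfolding f_def m_def by (simp add: e[unfolded m_def])
  qed
  then show thesis using that[of "\<lambda>k. sqrt (D_det n w) / pi ^ m * e k"]
    unfolding m_def by (simp add: sum_distrib_left mult.assoc)
qed

text \<open>
  The coefficients \<open>beta\<close> are chosen as some solution of the expansion, so what has to be shown is that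
  a solution exists. The powers of \<open>D\<close> in the expansion are absorbed into the coefficients.
\<close>

lemma gaussian_moment_beta:
  assumes n: "even n" and inj: "inj_on w {..<n div 2}" and \<sigma>: "\<sigma> > 0"
  shows "gaussian_moment n s w \<sigma>
    = (\<Sum>k\<le>n div 2. beta n s w k * (\<sigma> ^ (2 * k) / (2 ^ k * D_det n w ^ (n - k))))"
proof -
  obtain e where e: "\<And>\<sigma>. \<sigma> > 0 \<Longrightarrow> gaussian_moment n s w \<sigma> = (\<Sum>k\<le>n div 2. e k * \<sigma> ^ (2 * k))"
    using gaussian_moment_even_polynomial[OF n inj, of s] by blast
  have "D_det n w \<noteq> 0" using D_det_pos[OF inj] by simp
  then have "\<forall>\<sigma>>0. gaussian_moment n s w \<sigma> = (\<Sum>k\<le>n div 2.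
      (e k * (2 ^ k * D_det n w ^ (n - k))) * (\<sigma> ^ (2 * k) / (2 ^ k * D_det n w ^ (n - k))))"
    by (simp add: e)
  then have "\<exists>b. \<forall>\<sigma>>0. gaussian_moment n s w \<sigma>
      = (\<Sum>k\<le>n div 2. b k * (\<sigma> ^ (2 * k) / (2 ^ k * D_det n w ^ (n - k))))"
    by (rule exI[of _ "\<lambda>k. e k * (2 ^ k * D_det n w ^ (n - k))"])
  from someI_ex[OF this] show ?thesis unfolding beta_def[symmetric] using \<sigma> by blast
qed

section \<open>Integrating out the amplitudes\<close>

text \<open>
  Completing the square splits the exponential into the factor \<open>exp (- \<nu> / \<sigma>\<^sup>2)\<close>, constant in the
  amplitudes, and an unnormalised Gaussian, whose integral against the squared moduli is a moment.
\<close>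

lemma amplitude_integral:
  assumes n: "even n" and inj: "inj_on w {..<n div 2}" and \<sigma>: "\<sigma> > 0"
  shows "(LINT x|real_space {..<n}. (\<Prod>i<n div 2. (cmod (unstack (n div 2) x i))\<^sup>2)
      * exp (- (1 / \<sigma>\<^sup>2) * (\<Sum>k<n. (cmod (signal (n div 2) w (unstack (n div 2) x) k - s k))\<^sup>2)))
    = pi ^ (n div 2) * \<sigma> ^ n / sqrt (D_det n w) * gaussian_moment n s w \<sigma>
      * exp (- (1 / \<sigma>\<^sup>2) * nu n s w)"
proof -
  let ?q = "\<lambda>x. (vec n x - mu_real n s w) \<bullet> (Q_real n w *\<^sub>v (vec n x - mu_real n s w))"
  let ?F = "\<lambda>x. \<Prod>i<n div 2. (x i)\<^sup>2 + (x (n div 2 + i))\<^sup>2"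
  have D: "D_det n w > 0" by (rule D_det_pos[OF inj])
  have "(LINT x|real_space {..<n}. (\<Prod>i<n div 2. (cmod (unstack (n div 2) x i))\<^sup>2)
      * exp (- (1 / \<sigma>\<^sup>2) * (\<Sum>k<n. (cmod (signal (n div 2) w (unstack (n div 2) x) k - s k))\<^sup>2)))
      = (LINT x|real_space {..<n}. exp (- (1 / \<sigma>\<^sup>2) * nu n s w) * (?F x * exp (- (1 / \<sigma>\<^sup>2) * ?q x)))"
  proof (rule Bochner_Integration.integral_cong)
    fix x
    have F: "(\<Prod>i<n div 2. (cmod (unstack (n div 2) x i))\<^sup>2) = ?F x"
      by (simp add: unstack_def cmod_def)
    show "(\<Prod>i<n div 2. (cmod (unstack (n div 2) x i))\<^sup>2)
      * exp (- (1 / \<sigma>\<^sup>2) * (\<Sum>k<n. (cmod (signal (n div 2) w (unstack (n div 2) x) k - s k))\<^sup>2))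
      = exp (- (1 / \<sigma>\<^sup>2) * nu n s w) * (?F x * exp (- (1 / \<sigma>\<^sup>2) * ?q x))"
      unfolding F residual_completing_square[OF n inj] distrib_left exp_add by simp
  qed simp
  also have "\<dots> = exp (- (1 / \<sigma>\<^sup>2) * nu n s w) * (LINT x|real_space {..<n}. ?F x * exp (- (1 / \<sigma>\<^sup>2) * ?q x))"
    by simp
  also have "(LINT x|real_space {..<n}. ?F x * exp (- (1 / \<sigma>\<^sup>2) * ?q x))
      = pi ^ (n div 2) * \<sigma> ^ n / sqrt (D_det n w) * gaussian_moment n s w \<sigma>"
    unfolding gaussian_moment_eq[OF n inj \<sigma>] using D \<sigma> by simp
  finally show ?thesis by simp
qed

text \<open>
  The factor of \<open>\<bar>J_C\<bar>\<^sup>2\<close> that depends on the nodes alone.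
\<close>

definition node_repulsion :: "nat \<Rightarrow> nat \<Rightarrow> (nat \<Rightarrow> complex) \<Rightarrow> complex \<Rightarrow> real" where
  "node_repulsion m j \<zeta> z =
     (\<Prod>(r, h)\<in>{(r, h). r < h \<and> h < m \<and> r \<noteq> j \<and> h \<noteq> j}. cmod (\<zeta> r - \<zeta> h) ^ 8)
     * (\<Prod>r\<in>{..<m} - {j}. cmod (\<zeta> r - z) ^ 8)"

lemma cmod_J_C_squared:
  "(cmod (J_C n j \<gamma> \<zeta> z))\<^sup>2
    = (\<Prod>i<n div 2. (cmod (\<gamma> i))\<^sup>2) * node_repulsion (n div 2) j \<zeta> z"
  unfolding J_C_def node_repulsion_def
  by (simp add: norm_mult norm_power prod_norm[symmetric] power_mult_distrib prod_power_distrib[symmetric]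
      case_prod_unfold power_mult[symmetric])

lemma node_repulsion_collision:
  assumes j: "j < m" and coll: "\<not> inj_on (\<zeta>(j := z)) {..<m}"
  shows "node_repulsion m j \<zeta> z = 0"
proof -
  have fin: "finite {(r, h). r < h \<and> h < m \<and> r \<noteq> j \<and> h \<noteq> j}"
    by (rule finite_subset[of _ "{..<m} \<times> {..<m}"]) auto
  obtain a b where ab: "a < b" "b < m" "(\<zeta>(j := z)) a = (\<zeta>(j := z)) b"
    using coll unfolding inj_on_def by (metis lessThan_iff linorder_neqE_nat)
  consider "a = j" | "b = j" | "a \<noteq> j" "b \<noteq> j" by blast
  then show ?thesis
  proof cases
    case 1
    then have "\<zeta> b = z" "b \<in> {..<m} - {j}" using ab by auto
    then show ?thesis unfolding node_repulsion_def by force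
  next
    case 2
    then have "\<zeta> a = z" "a \<in> {..<m} - {j}" using ab by auto
    then show ?thesis unfolding node_repulsion_def by force
  next
    case 3
    then have "\<zeta> a = \<zeta> b" using ab by simp
    with 3 ab fin have "(\<Prod>(r, h)\<in>{(r, h). r < h \<and> h < m \<and> r \<noteq> j \<and> h \<noteq> j}. cmod (\<zeta> r - \<zeta> h) ^ 8) = 0"
      by (subst prod_zero_iff) (auto intro!: bexI[of _ "(a, b)"])
    then show ?thesis unfolding node_repulsion_def by simp
  qed
qed

lemma g_density_collision:
  assumes "j < n div 2" "\<not> inj_on (\<zeta>(j := z)) {..<n div 2}"
  shows "g_density n s j \<zeta> z \<sigma> = 0"
  using node_repulsion_collision[OF assms] unfolding g_density_def node_repulsion_def[symmetric] by simp

text \<open>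
  The half-integer power of \<open>D\<close> is \<open>D\<^bsup>n - k\<^esup>\<close>, which the expansion of the moment supplies, times
  \<open>sqrt D\<close>, which comes from the normalising constant of the Gaussian.
\<close>

lemma g_density_distinct:
  assumes n: "even n" and inj: "inj_on (\<zeta>(j := z)) {..<n div 2}" and \<sigma>: "\<sigma> > 0"
  shows "g_density n s j \<zeta> z \<sigma> = node_repulsion (n div 2) j \<zeta> z
    / (\<sigma> ^ n * pi ^ (n div 2) * sqrt (D_det n (\<zeta>(j := z)))) * gaussian_moment n s (\<zeta>(j := z)) \<sigma>"
proof -
  define D where "D = D_det n (\<zeta>(j := z))"
  have D: "D > 0" unfolding D_def by (rule D_det_pos[OF inj])
  have powr: "D powr (real n - real k + 1 / 2) = D ^ (n - k) * sqrt D" if "k \<le> n div 2" for k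
  proof -
    have "k \<le> n" using that by simp
    then have "real n - real k + 1 / 2 = real (n - k) + 1 / 2" by simp
    then show ?thesis using D by (simp only: powr_add powr_realpow powr_half_sqrt less_imp_le)
  qed
  show ?thesis
    unfolding g_density_def node_repulsion_def[symmetric] gaussian_moment_beta[OF n inj \<sigma>] D_def[symmetric]
    using powr by (simp add: sum_distrib_left mult_ac)
qed

theorem corollary1p6:
  fixes n p j :: nat and c \<xi> s :: "nat \<Rightarrow> complex" and z :: complex and \<sigma> :: real
  assumes "even n" and "n > 2"
    and "p \<le> n div 2"
    and "inj_on \<xi> {1..p}"
    and "\<And>k. k < n \<Longrightarrow> s k = (\<Sum>l=1..p. c l * \<xi> l ^ k)"
    and "\<sigma> > 0"
    and "j < n div 2"
  shows "h_density n s j z \<sigma> =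
    (LINT y|real_space ({..<n} - {j, n div 2 + j}).
       (let \<zeta> = unstack (n div 2) y in
          g_density n s j \<zeta> z \<sigma> * exp (- (1 / \<sigma>\<^sup>2) * nu n s (\<zeta>(j := z)))))"
proof -
  let ?m = "n div 2"
  have signal: "(\<Sum>h\<in>{..<?m} - {j}. \<gamma> h * \<zeta> h ^ k) + \<gamma> j * z ^ k = signal ?m (\<zeta>(j := z)) \<gamma> k" for \<gamma> \<zeta> k
  proof -
    have "signal ?m (\<zeta>(j := z)) \<gamma> k = \<gamma> j * z ^ k + (\<Sum>h\<in>{..<?m} - {j}. \<gamma> h * (\<zeta>(j := z)) h ^ k)"
      unfolding signal_def using \<open>j < ?m\<close> by (subst sum.remove[of _ j]) auto
    also have "(\<Sum>h\<in>{..<?m} - {j}. \<gamma> h * (\<zeta>(j := z)) h ^ k) = (\<Sum>h\<in>{..<?m} - {j}. \<gamma> h * \<zeta> h ^ k)"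
      by (intro sum.cong) auto
    finally show ?thesis by (simp only: add.commute)
  qed
  have inner: "1 / (pi * \<sigma>\<^sup>2) ^ n * (LINT x|real_space {..<n}. (cmod (J_C n j (unstack ?m x) \<zeta> z))\<^sup>2 *
        exp (- (1 / \<sigma>\<^sup>2) * (\<Sum>k<n. (cmod (signal ?m (\<zeta>(j := z)) (unstack ?m x) k - s k))\<^sup>2)))
      = g_density n s j \<zeta> z \<sigma> * exp (- (1 / \<sigma>\<^sup>2) * nu n s (\<zeta>(j := z)))" for \<zeta>
  proof (cases "inj_on (\<zeta>(j := z)) {..<?m}")
    case False
    \<comment> \<open>At a collision the matrices are singular, but the product of node differences vanishes.\<close>
    then show ?thesis
      by (simp add: cmod_J_C_squared node_repulsion_collision[OF \<open>j < ?m\<close>] g_density_collision[OF \<open>j < ?m\<close>])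
  next
    case True
    define P where "P = pi ^ ?m * \<sigma> ^ n"
    have P: "(pi * \<sigma>\<^sup>2) ^ n = P * P" "P \<noteq> 0"
      unfolding P_def using \<open>even n\<close> \<open>\<sigma> > 0\<close>
      by (auto simp: power_mult_distrib power_mult[symmetric] power_add mult_2 elim!: evenE)
    define R where "R = node_repulsion ?m j \<zeta> z"
    have "(LINT x|real_space {..<n}. (cmod (J_C n j (unstack ?m x) \<zeta> z))\<^sup>2 *
        exp (- (1 / \<sigma>\<^sup>2) * (\<Sum>k<n. (cmod (signal ?m (\<zeta>(j := z)) (unstack ?m x) k - s k))\<^sup>2)))
      = (LINT x|real_space {..<n}. R * ((\<Prod>i<?m. (cmod (unstack ?m x i))\<^sup>2) *
        exp (- (1 / \<sigma>\<^sup>2) * (\<Sum>k<n. (cmod (signal ?m (\<zeta>(j := z)) (unstack ?m x) k - s k))\<^sup>2))))"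
      unfolding cmod_J_C_squared R_def by (simp only: mult_ac)
    also have "\<dots> = R * (P / sqrt (D_det n (\<zeta>(j := z))) * gaussian_moment n s (\<zeta>(j := z)) \<sigma>
      * exp (- (1 / \<sigma>\<^sup>2) * nu n s (\<zeta>(j := z))))"
      unfolding integral_mult_right_zero amplitude_integral[OF \<open>even n\<close> True \<open>\<sigma> > 0\<close>] P_def ..
    finally show ?thesis
      unfolding g_density_distinct[OF \<open>even n\<close> True \<open>\<sigma> > 0\<close>] P(1) using P(2) \<open>\<sigma> > 0\<close>
      by (simp add: R_def[symmetric] P_def mult_ac)
  qed
  show ?thesis
    unfolding h_density_def Let_def signal inner[symmetric]
    by (rule integral_mult_right_zero[symmetric])
qed

end
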